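(* Consider the opportunistic beamforming network described in the context with path loss model $G(d)=(1+d^{\alpha})^{-1}$, where $\alpha>2$. For a given communication rate $x>0$, the beam outage probability $F_{\mathrm{b},r}(x)$ is equal to $F^\star_{\mathrm{b},\gamma}(e^x-1)$, where, for $x>0$, $$F^\star_{\mathrm{b},\gamma}(x)=\exp\left(\frac{-2\lambda\pi\, e^{-x/\rho}}{\alpha(x+1)^{M-1}}\left(\frac{\rho}{x}\right)^{\frac{2}{\alpha}}\gamma\left(\frac{2}{\alpha},\frac{xD^\alpha}{\rho}\right)\right),$$ and $\gamma(s,z)=\int_0^z t^{s-1}e^{-t}\,dt$ is the lower incomplete gamma function.
   Context: Network model. The cell is the disk of radius $D>0$ in the plane with the base station (BS) at its center. Mobile users (MUs) are distributed over the plane according to a homogeneous Poisson point process of intensity $\lambda>0$. Let $N$ be the (random) number of MUs in the cell, so $N$ is Poisson with mean $\lambda\pi D^2$; given $N$, the MU locations in the cell are i.i.d. uniform on the disk. The BS has $M\ge 1$ antennas, each MU has a single antenna, and the BS uses $M$ orthonormal beamforming vectors $\boldsymbol b_1,\dots,\boldsymbol b_M\in\mathbb C^M$ (generated independently of everything else), with transmit power $\rho>0$ per beam. The fading vector $\boldsymbol h_i\in\mathbb C^M$ of MU $i$ has i.i.d. entries drawn from the zero-mean unit-variance circularly-symmetric complex Gaussian distribution $\mathcal{CN}(0,1)$; fading vectors are independent across MUs and independent of the MU locations. The path loss coefficient of MU $i$ is $g_i=G(d_i)$, where $d_i$ is its distance from the BS. SINR. The signal-to-interference-plus-noise ratio of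 beam $m$ at MU $i$ is $$\gamma_{m,i}=\frac{|\boldsymbol h_i^\top\boldsymbol b_m|^2}{(\rho g_i)^{-1}+\sum_{k\ne m}|\boldsymbol h_i^\top\boldsymbol b_k|^2}.$$ Rate and outage. The BS schedules on each beam the MU in the cell with the highest SINR on that beam; the rate on beam $m$ is $r_m=\log\left(1+\max_i\gamma_{m,i}\right)$, the maximum being over the $N$ MUs in the cell and taken to be $0$ if $N=0$. $F^\star_{\mathrm{b},\gamma}$ denotes the cumulative distribution function of $\max_i\gamma_{m,i}$ (it does not depend on $m$) for this path loss model. The beam outage probability at target rate $x$ is $F_{\mathrm{b},r}(x)=\Pr\{r_m\le x\}$. *)

theory Defs
  imports "HOL-Probability.Probability"
begin

type_synonym plane = "real ^ 2"

definition lower_incomplete_gamma :: "real \<Rightarrow> real \<Rightarrow> real" where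
  "lower_incomplete_gamma s z = integral {0..z} (\<lambda>t. t powr (s - 1) * exp (- t))"

text \<open>The transpose product of two complex vectors: bilinear, without conjugation.\<close>

definition tdot :: "complex ^ 'm \<Rightarrow> complex ^ 'm \<Rightarrow> complex" where
  "tdot u v = (\<Sum>j\<in>UNIV. u $ j * v $ j)"

text \<open>Orthonormality refers to the Hermitian inner product; the library's \<open>\<bullet>\<close> on
  complex vectors is only its real part.\<close>

definition orthonormal_family :: "('k \<Rightarrow> complex ^ 'm) \<Rightarrow> bool" where
  "orthonormal_family b \<longleftrightarrow>
     (\<forall>k l. (\<Sum>j\<in>UNIV. cnj (b k $ j) * b l $ j) = (if k = l then 1 else 0))"

context prob_space
begin

text \<open>Independence of two random elements, whose value types may differ
  (unlike in \<^const>\<open>indep_var\<close>).\<close>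

definition indep_rv :: "'b measure \<Rightarrow> ('a \<Rightarrow> 'b) \<Rightarrow> 'c measure \<Rightarrow> ('a \<Rightarrow> 'c) \<Rightarrow> bool" where
  "indep_rv N1 Z1 N2 Z2 \<longleftrightarrow>
     random_variable N1 Z1 \<and> random_variable N2 Z2 \<and>
     indep_set {Z1 -` A \<inter> space M | A. A \<in> sets N1} {Z2 -` A \<inter> space M | A. A \<in> sets N2}"

text \<open>Circular symmetry, zero mean and unit variance: real and imaginary parts are
  independent with law \<open>N(0, 1/2)\<close>; the library's normal density takes the standard deviation.\<close>

definition std_complex_gaussian :: "('a \<Rightarrow> complex) \<Rightarrow> bool" where
  "std_complex_gaussian Z \<longleftrightarrow>
     random_variable borel Z \<and>
     distributed M lborel (\<lambda>w. Re (Z w)) (normal_density 0 (sqrt (1 / 2))) \<and>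
     distributed M lborel (\<lambda>w. Im (Z w)) (normal_density 0 (sqrt (1 / 2))) \<and>
     indep_var borel (\<lambda>w. Re (Z w)) borel (\<lambda>w. Im (Z w))"

text \<open>The points of a homogeneous Poisson process of positive intensity on the whole plane are
  almost surely infinite in number, so they are enumerated as \<open>X 0, X 1, \<dots>\<close> in a measurable
  way. \<^const>\<open>card\<close> counts correctly here because of local finiteness.\<close>

definition count_in :: "(nat \<Rightarrow> 'a \<Rightarrow> plane) \<Rightarrow> plane set \<Rightarrow> 'a \<Rightarrow> nat" where
  "count_in X A w = card {i. X i w \<in> A}"

definition homogeneous_ppp :: "real \<Rightarrow> (nat \<Rightarrow> 'a \<Rightarrow> plane) \<Rightarrow> bool" where
  "homogeneous_ppp lam X \<longleftrightarrow>
     (\<forall>i. random_variable borel (X i)) \<and>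
     (\<forall>w\<in>space M. \<forall>A. bounded A \<longrightarrow> finite {i. X i w \<in> A}) \<and>
     (\<forall>A\<in>sets borel. bounded A \<longrightarrow>
        (\<forall>k. prob {w \<in> space M. count_in X A w = k} =
              exp (- (lam * measure lborel A)) * (lam * measure lborel A) ^ k / fact k)) \<and>
     (\<forall>(A :: nat \<Rightarrow> plane set) I. finite I \<longrightarrow> disjoint_family_on A I \<longrightarrow>
        (\<forall>j\<in>I. A j \<in> sets borel \<and> bounded (A j)) \<longrightarrow>
        indep_vars (\<lambda>_. count_space UNIV) (\<lambda>j. count_in X (A j)) I)"

end

text \<open>The base station is at the origin. Both the antennas and the beams are indexed by the
  finite type \<open>'m\<close>, so that \<open>CARD('m)\<close> is the number of antennas. The fading vectors and the
  locations of the mobile users share the index \<open>i\<close>. The last two assumptions together say that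
  locations, fading and beams are jointly independent.\<close>

locale obf_network = prob_space \<Omega> for \<Omega> :: "'w measure" +
  fixes lam D rho :: real
    and X :: "nat \<Rightarrow> 'w \<Rightarrow> plane"
    and h :: "nat \<Rightarrow> 'w \<Rightarrow> complex ^ 'm"
    and b :: "'m \<Rightarrow> 'w \<Rightarrow> complex ^ 'm"
  assumes lam_pos: "lam > 0" and D_pos: "D > 0" and rho_pos: "rho > 0"
    and users_ppp: "homogeneous_ppp lam X"
    and fading_entries_gaussian: "\<And>i j. std_complex_gaussian (\<lambda>w. h i w $ j)"
    and fading_entries_indep: "\<And>i. indep_vars (\<lambda>_. borel) (\<lambda>j w. h i w $ j) UNIV"
    and fading_indep: "indep_vars (\<lambda>_. borel) h UNIV"
    and beams_orthonormal: "\<And>w. w \<in> space \<Omega> \<Longrightarrow> orthonormal_family (\<lambda>k. b k w)"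
    and fading_indep_locations:
      "indep_rv (PiM UNIV (\<lambda>_. borel)) (\<lambda>w i. h i w) (PiM UNIV (\<lambda>_. borel)) (\<lambda>w i. X i w)"
    and beams_indep:
      "indep_rv (PiM UNIV (\<lambda>_. borel)) (\<lambda>w k. b k w)
         (PiM UNIV (\<lambda>_. borel) \<Otimes>\<^sub>M PiM UNIV (\<lambda>_. borel)) (\<lambda>w. (\<lambda>i. h i w, \<lambda>i. X i w))"

definition sinr ::
  "real \<Rightarrow> (real \<Rightarrow> real) \<Rightarrow> (nat \<Rightarrow> 'w \<Rightarrow> plane) \<Rightarrow> (nat \<Rightarrow> 'w \<Rightarrow> complex ^ 'm) \<Rightarrow>
   ('m \<Rightarrow> 'w \<Rightarrow> complex ^ 'm) \<Rightarrow> 'm \<Rightarrow> nat \<Rightarrow> 'w \<Rightarrow> real" where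
  "sinr rho G X h b m i w =
     (cmod (tdot (h i w) (b m w)))\<^sup>2 /
     (inverse (rho * G (norm (X i w))) + (\<Sum>k\<in>UNIV - {m}. (cmod (tdot (h i w) (b k w)))\<^sup>2))"

definition users_in_cell :: "real \<Rightarrow> (nat \<Rightarrow> 'w \<Rightarrow> plane) \<Rightarrow> 'w \<Rightarrow> nat set" where
  "users_in_cell D X w = {i. X i w \<in> cball 0 D}"

definition max_sinr ::
  "real \<Rightarrow> real \<Rightarrow> (real \<Rightarrow> real) \<Rightarrow> (nat \<Rightarrow> 'w \<Rightarrow> plane) \<Rightarrow> (nat \<Rightarrow> 'w \<Rightarrow> complex ^ 'm) \<Rightarrow>
   ('m \<Rightarrow> 'w \<Rightarrow> complex ^ 'm) \<Rightarrow> 'm \<Rightarrow> 'w \<Rightarrow> real" where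
  "max_sinr D rho G X h b m w =
     (if users_in_cell D X w = {} then 0
      else Max ((\<lambda>i. sinr rho G X h b m i w) ` users_in_cell D X w))"

definition beam_rate ::
  "real \<Rightarrow> real \<Rightarrow> (real \<Rightarrow> real) \<Rightarrow> (nat \<Rightarrow> 'w \<Rightarrow> plane) \<Rightarrow> (nat \<Rightarrow> 'w \<Rightarrow> complex ^ 'm) \<Rightarrow>
   ('m \<Rightarrow> 'w \<Rightarrow> complex ^ 'm) \<Rightarrow> 'm \<Rightarrow> 'w \<Rightarrow> real" where
  "beam_rate D rho G X h b m w = ln (1 + max_sinr D rho G X h b m w)"

definition beam_outage ::
  "'w measure \<Rightarrow> real \<Rightarrow> real \<Rightarrow> (real \<Rightarrow> real) \<Rightarrow> (nat \<Rightarrow> 'w \<Rightarrow> plane) \<Rightarrow>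
   (nat \<Rightarrow> 'w \<Rightarrow> complex ^ 'm) \<Rightarrow> ('m \<Rightarrow> 'w \<Rightarrow> complex ^ 'm) \<Rightarrow> 'm \<Rightarrow> real \<Rightarrow> real" where
  "beam_outage \<Omega> D rho G X h b m x =
     measure \<Omega> {w \<in> space \<Omega>. beam_rate D rho G X h b m w \<le> x}"

definition max_sinr_cdf ::
  "'w measure \<Rightarrow> real \<Rightarrow> real \<Rightarrow> (real \<Rightarrow> real) \<Rightarrow> (nat \<Rightarrow> 'w \<Rightarrow> plane) \<Rightarrow>
   (nat \<Rightarrow> 'w \<Rightarrow> complex ^ 'm) \<Rightarrow> ('m \<Rightarrow> 'w \<Rightarrow> complex ^ 'm) \<Rightarrow> 'm \<Rightarrow> real \<Rightarrow> real" where
  "max_sinr_cdf \<Omega> D rho G X h b m = cdf (distr \<Omega> borel (max_sinr D rho G X h b m))"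

definition path_loss :: "real \<Rightarrow> real \<Rightarrow> real" where
  "path_loss \<alpha> d = inverse (1 + d powr \<alpha>)"

end

theory Submission
  imports Defs
begin

text \<open>
  For fixed orthonormal beams, \<open>h \<mapsto> (h\<^sup>T b\<^sub>k)\<^sub>k\<close> is an isometry of a complex Gaussian vector, hence preserves
  its law, and the beam powers are independent standard exponentials. The SINR of a user at distance \<open>r\<close>
  exceeds \<open>y\<close> iff \<open>E\<^sub>m > y (c + (\<Sum>k\<noteq>m. E\<^sub>k))\<close> with \<open>c = (1 + r\<^sup>\<alpha>) / rho\<close>, which has probability
  \<open>q(r) = e\<^bsup>-yc\<^esup> / (1 + y)\<^bsup>M-1\<^esup>\<close>. Averaging over the fading first, the maximum stays below \<open>y\<close> with
  probability \<open>E[\<Prod>i. (1 - q(r\<^sub>i))]\<close>. This value of the generating functional of the Poisson process is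
  squeezed between products over equal-area annuli and equals \<open>exp(- lam \<pi> \<integral> q(\<surd>s) ds)\<close> over
  \<open>[0, D\<^sup>2]\<close>; the substitution \<open>t = y s\<^bsup>\<alpha>/2\<^esup> / rho\<close> turns the integral into an incomplete gamma function.
\<close>

section \<open>Complex Gaussian vectors and orthogonal maps\<close>

lemma distr_lborel_orthogonal:
  fixes T :: "'a::euclidean_space \<Rightarrow> 'a"
  assumes "orthogonal_transformation T"
  shows "distr lborel borel T = lborel"
proof -
  txt \<open>Library results on linear images need a well-ordered index type. Instead, as in the proof that
    translation-invariant measures are proportional, compare the two measures on \<open>A \<times> ball 0 1\<close>; the
    exchange of the variables leaves a reflection behind.\<close>
  have reflected: "distr lborel borel (\<lambda>x. - U x) = lborel"
    if U: "orthogonal_transformation U" for U :: "'a \<Rightarrow> 'a"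
  proof (rule measure_eqI)
    have lin: "linear U" using U by (rule orthogonal_transformation_linear)
    have mU[measurable]: "U \<in> borel_measurable borel"
      using lin by (intro borel_measurable_continuous_onI linear_continuous_on) (simp add: linear_linear)
    have surj: "surj U" using U by (rule orthogonal_transformation_surj)
    let ?B = "ball 0 1 :: 'a set"
    have shift: "(\<integral>\<^sup>+y. f y \<partial>lborel) = (\<integral>\<^sup>+y. f (c + y) \<partial>lborel)"
      if [measurable]: "f \<in> borel_measurable borel" for f :: "'a \<Rightarrow> ennreal" and c
      by (subst lborel_distr_plus[of c, symmetric]) (simp add: nn_integral_distr)
    have [measurable]: "?B \<in> sets borel" by simp
    fix A assume "A \<in> sets (distr lborel borel (\<lambda>x. - U x))"
    then have A[measurable]: "A \<in> sets borel" by simp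
    have normU: "norm (U y) = norm y" for y
      using U by (rule orthogonal_transformation_norm)
    have "emeasure lborel A * emeasure lborel ?B = (\<integral>\<^sup>+x. indicator A x * (\<integral>\<^sup>+y. indicator ?B (U y) \<partial>lborel) \<partial>lborel)"
    proof -
      have "indicator ?B (U y) = (indicator ?B y :: ennreal)" for y
        by (simp add: indicator_def normU)
      then show ?thesis by (simp add: nn_integral_multc)
    qed
    also have "\<dots> = (\<integral>\<^sup>+x. (\<integral>\<^sup>+y. indicator A x * indicator ?B (x + U y) \<partial>lborel) \<partial>lborel)"
    proof (rule nn_integral_cong)
      fix x :: 'a
      \<comment> \<open>Because \<open>U\<close> is onto, \<open>x\<close> is the image of some
        \<open>c\<close>, so translating the argument by \<open>c\<close> translates its image under
        \<open>U\<close> by \<open>x\<close>.\<close>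
      obtain c where c: "x = U c" using surj by (auto simp: surj_def)
      have "(\<integral>\<^sup>+y. indicator ?B (U y) \<partial>lborel) = (\<integral>\<^sup>+y. indicator ?B (U (c + y)) \<partial>lborel :: ennreal)"
        by (rule shift) measurable
      then show "indicator A x * (\<integral>\<^sup>+y. indicator ?B (U y) \<partial>lborel) =
          (\<integral>\<^sup>+y. indicator A x * indicator ?B (x + U y) \<partial>lborel)"
        by (simp add: nn_integral_cmult c linear_add[OF lin])
    qed
    also have "\<dots> = (\<integral>\<^sup>+y. (\<integral>\<^sup>+x. indicator A x * indicator ?B (x + U y) \<partial>lborel) \<partial>lborel)"
      by (rule lborel_pair.Fubini') measurable
    also have "\<dots> = (\<integral>\<^sup>+y. (\<integral>\<^sup>+x. indicator A (x - U y) * indicator ?B x \<partial>lborel) \<partial>lborel)"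
    proof (rule nn_integral_cong)
      fix y :: 'a
      show "(\<integral>\<^sup>+x. indicator A x * indicator ?B (x + U y) \<partial>lborel) =
          (\<integral>\<^sup>+x. indicator A (x - U y) * indicator ?B x \<partial>lborel :: ennreal)"
        by (subst shift[of _ "- U y"]) simp_all
    qed
    also have "\<dots> = (\<integral>\<^sup>+x. (\<integral>\<^sup>+y. indicator A (x - U y) * indicator ?B x \<partial>lborel) \<partial>lborel)"
      by (rule lborel_pair.Fubini') measurable
    also have "\<dots> = (\<integral>\<^sup>+x. (\<integral>\<^sup>+y. indicator A (- U y) \<partial>lborel) * indicator ?B x \<partial>lborel)"
    proof (rule nn_integral_cong)
      fix x :: 'a
      obtain c where c: "x = U c" using surj by (auto simp: surj_def)
      have "(\<integral>\<^sup>+y. indicator A (x - U y) \<partial>lborel) = (\<integral>\<^sup>+y. indicator A (x - U (c + y)) \<partial>lborel :: ennreal)"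
        by (rule shift) measurable
      then show "(\<integral>\<^sup>+y. indicator A (x - U y) * indicator ?B x \<partial>lborel) =
          (\<integral>\<^sup>+y. indicator A (- U y) \<partial>lborel) * indicator ?B x"
        by (simp add: nn_integral_multc c linear_add[OF lin])
    qed
    also have "\<dots> = emeasure (distr lborel borel (\<lambda>x. - U x)) A * emeasure lborel ?B"
    proof -
      have "(\<integral>\<^sup>+y. indicator A (- U y) \<partial>lborel) = emeasure (distr lborel borel (\<lambda>x. - U x)) A"
        by (simp add: nn_integral_distr flip: nn_integral_indicator)
      then show ?thesis by (simp add: nn_integral_cmult)
    qed
    finally have *: "emeasure (distr lborel borel (\<lambda>x. - U x)) A * emeasure lborel ?B =
        emeasure lborel A * emeasure lborel ?B" by simp
    \<comment> \<open>The volume of the unit ball is positive and finite, so it cancels in extended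
      nonnegative arithmetic.\<close>
    have "unit_ball_vol (real DIM('a)) \<noteq> 0"
      using unit_ball_vol_pos[of "real DIM('a)"] by linarith
    then have "emeasure lborel ?B \<noteq> 0" "emeasure lborel ?B \<noteq> \<top>"
      by (simp_all add: emeasure_ball)
    then show "emeasure (distr lborel borel (\<lambda>x. - U x)) A = emeasure lborel A"
      using * by (metis mult_divide_eq_ennreal)
  qed simp
  \<comment> \<open>Applied to the negative of \<open>T\<close>, the reflected statement yields the
    one for \<open>T\<close> itself.\<close>
  have "orthogonal_transformation (\<lambda>x. - T x)"
    using assms by (simp add: orthogonal_transformation_def linear_compose_neg)
  from reflected[OF this] show ?thesis by simp
qed

lemma Basis_vec_eq_image:
  "(Basis :: ('a::euclidean_space ^ 'n) set) = (\<lambda>(j, u). axis j u) ` (UNIV \<times> Basis)"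
  by (auto simp: Basis_vec_def)

lemma prod_Basis_vec:
  "(\<Prod>v\<in>(Basis :: ('a::euclidean_space ^ 'n) set). f v) = (\<Prod>j\<in>UNIV. \<Prod>u\<in>Basis. f (axis j u))"
proof -
  have "inj_on (\<lambda>(j, u). axis j u) (UNIV \<times> (Basis :: 'a set))"
    by (auto simp: inj_on_def axis_eq_axis)
  from prod.reindex[OF this, of f] show ?thesis
    by (simp add: Basis_vec_eq_image prod.cartesian_product split_def comp_def)
qed

lemma prod_Basis_complex_vec:
  "(\<Prod>v\<in>(Basis :: (complex ^ 'n) set). f v) = (\<Prod>j\<in>UNIV. f (axis j 1) * f (axis j \<i>))"
  by (simp add: prod_Basis_vec Basis_complex_def)

text \<open>With variance 1/2 a coordinate has density exp(-t^2)/sqrt(pi), so the squares in the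
  exponents add up to the squared norm. That the product depends on the norm alone is the source of
  rotation invariance.\<close>

lemma prod_normal_density:
  fixes v :: "'a::euclidean_space"
  shows "(\<Prod>u\<in>Basis. normal_density 0 (sqrt (1 / 2)) (v \<bullet> u)) = exp (- (norm v)\<^sup>2) / sqrt pi ^ DIM('a)"
proof -
  have "normal_density 0 (sqrt (1 / 2)) t = exp (- t\<^sup>2) / sqrt pi" for t
    by (simp add: normal_density_def real_sqrt_divide power_divide)
  moreover have "(norm v)\<^sup>2 = (\<Sum>u\<in>Basis. (v \<bullet> u)\<^sup>2)"
    by (subst power2_norm_eq_inner, subst euclidean_inner) (simp add: power2_eq_square)
  ultimately show ?thesis
    by (simp add: prod_dividef exp_sum sum_negf[symmetric])
qed

text \<open>Open boxes are stable under intersection and generate the Borel sets. The probability of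
  a box factors twice: over the entries by their independence, and within an entry over real and
  imaginary part. The integral of the product density factors in the same way.\<close>

lemma (in prob_space) distr_gaussian_vector:
  fixes Z :: "'a \<Rightarrow> complex ^ 'n"
  assumes Z[measurable]: "random_variable borel Z"
    and indep: "indep_vars (\<lambda>_. borel) (\<lambda>j w. Z w $ j) UNIV"
    and gauss: "\<And>j. std_complex_gaussian (\<lambda>w. Z w $ j)"
  shows "distr M borel Z =
    density lborel (\<lambda>v. ennreal (exp (- (norm v)\<^sup>2) / sqrt pi ^ DIM(complex ^ 'n)))"
    (is "_ = density _ ?g")
proof (rule measure_eqI_generator_eq)
  let ?nd = "normal_density 0 (sqrt (1 / 2))"
  let ?E = "range (\<lambda>(a, b). box a b :: (complex ^ 'n) set)"
  show "Int_stable ?E"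
    by (auto simp: Int_stable_def box_Int_box)
  show "?E \<subseteq> Pow UNIV" "sets (distr M borel Z) = sigma_sets UNIV ?E"
    "sets (density lborel ?g) = sigma_sets UNIV ?E"
    by (simp_all add: borel_eq_box)
  let ?A = "\<lambda>n::nat. box (- (real n *\<^sub>R One)) (real n *\<^sub>R One) :: (complex ^ 'n) set"
  show "range ?A \<subseteq> ?E" "(\<Union>i. ?A i) = UNIV"
    unfolding UN_box_eq_UNIV by auto
  show "emeasure (distr M borel Z) (?A i) \<noteq> \<infinity>" for i
    by (simp add: emeasure_distr)
  fix B assume "B \<in> ?E"
  then obtain l u where B: "B = box l u" by auto
  have [measurable]: "(\<lambda>w. Z w $ j) \<in> borel_measurable M" for j
    using gauss by (simp add: std_complex_gaussian_def)
  let ?I = "\<lambda>k. \<integral>\<^sup>+t. ennreal (?nd t) * indicator {l \<bullet> k <..< u \<bullet> k} t \<partial>lborel"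
  have Re: "prob {w\<in>space M. Re (Z w $ j) \<in> {a<..<b}} = (\<integral>\<^sup>+t. ennreal (?nd t) * indicator {a<..<b} t \<partial>lborel)"
    and Im: "prob {w\<in>space M. Im (Z w $ j) \<in> {a<..<b}} = (\<integral>\<^sup>+t. ennreal (?nd t) * indicator {a<..<b} t \<partial>lborel)" for j a b
    using gauss[of j] distributed_emeasure[of M lborel "\<lambda>w. Re (Z w $ j)" ?nd "{a<..<b}"] distributed_emeasure[of M lborel "\<lambda>w. Im (Z w $ j)" ?nd "{a<..<b}"]
    by (simp_all add: std_complex_gaussian_def emeasure_eq_measure vimage_def Int_def conj_commute)
  \<comment> \<open>The basis vectors \<open>axis j 1\<close> and \<open>axis j \<i>\<close> pick
    out the real and the imaginary part of entry \<open>j\<close>, so a box in the plane of this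
    entry is a product of two intervals.\<close>
  have coord: "prob {w\<in>space M. Z w $ j \<in> box (l $ j) (u $ j)} = ?I (axis j 1) * ?I (axis j \<i>)" for j
  proof -
    have "{w\<in>space M. Z w $ j \<in> box (l $ j) (u $ j)} =
      (\<lambda>w. (Re (Z w $ j), Im (Z w $ j))) -` ({Re (l $ j)<..<Re (u $ j)} \<times> {Im (l $ j)<..<Im (u $ j)}) \<inter> space M"
      by (auto simp: box_def Basis_complex_def)
    moreover have "indep_var borel (\<lambda>w. Re (Z w $ j)) borel (\<lambda>w. Im (Z w $ j))"
      using gauss[of j] by (simp add: std_complex_gaussian_def)
    ultimately have "prob {w\<in>space M. Z w $ j \<in> box (l $ j) (u $ j)} =
      prob {w\<in>space M. Re (Z w $ j) \<in> {Re (l $ j)<..<Re (u $ j)}} * prob {w\<in>space M. Im (Z w $ j) \<in> {Im (l $ j)<..<Im (u $ j)}}"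
      by (simp only:) (subst indep_varD, auto simp: vimage_def Int_def conj_commute)
    then show ?thesis
      by (simp add: ennreal_mult Re[simplified] Im[simplified] inner_axis)
  qed
  have "emeasure (distr M borel Z) B = prob (\<Inter>j. (\<lambda>w. Z w $ j) -` box (l $ j) (u $ j) \<inter> space M)"
    by (auto simp: B emeasure_distr emeasure_eq_measure mem_box Basis_vec_def inner_axis intro!: arg_cong[where f=prob])
  also have "\<dots> = (\<Prod>j\<in>UNIV. prob ((\<lambda>w. Z w $ j) -` box (l $ j) (u $ j) \<inter> space M))"
    using indep by (subst indep_varsD[of _ _ UNIV UNIV]) auto
  also have "\<dots> = (\<Prod>j\<in>UNIV. ennreal (prob {w\<in>space M. Z w $ j \<in> box (l $ j) (u $ j)}))"
    by (subst prod_ennreal) (simp_all add: vimage_def Int_def conj_commute)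
  also have "\<dots> = (\<Prod>k\<in>Basis. ?I k)"
    by (simp add: prod_Basis_complex_vec coord)
  also have "\<dots> = (\<integral>\<^sup>+v. (\<Prod>k\<in>Basis. ennreal (?nd (v \<bullet> k)) * indicator {l \<bullet> k <..< u \<bullet> k} (v \<bullet> k)) \<partial>lborel)"
    by (subst nn_integral_lborel_prod) simp_all
  also have "\<dots> = (\<integral>\<^sup>+v. ?g v * indicator B v \<partial>lborel)"
    by (intro nn_integral_cong)
      (auto simp: B prod.distrib prod_ennreal prod_normal_density box_def indicator_def)
  also have "\<dots> = emeasure (density lborel ?g) B"
    using B by (simp add: emeasure_density)
  finally show "emeasure (distr M borel Z) B = emeasure (density lborel ?g) B" .
qed

section \<open>Invariance of the complex Gaussian law under projection onto orthonormal
  beams\<close>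

definition beam_transform :: "('m \<Rightarrow> complex ^ 'm) \<Rightarrow> complex ^ 'm \<Rightarrow> complex ^ 'm" where
  "beam_transform b v = (\<chi> k. tdot v (b k))"

lemma beam_transform_nth [simp]: "beam_transform b v $ k = tdot v (b k)"
  by (simp add: beam_transform_def)

lemma beam_transform_measurable [measurable]:
  "beam_transform b \<in> borel_measurable borel"
  unfolding beam_transform_def tdot_def
  by (intro borel_measurable_continuous_onI continuous_intros)

lemma norm_vec_power2: "(norm v)\<^sup>2 = (\<Sum>k\<in>UNIV. (norm (v $ k))\<^sup>2)"
  by (simp add: norm_vec_def L2_set_def sum_nonneg)

text \<open>The matrix \<open>B\<close> has the beams as rows and \<open>B'\<close> is its conjugate
  transpose. Orthonormality of the rows says that \<open>B'\<close> is a right inverse; as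
  \<open>B\<close> is square it is also a left inverse, so the columns are orthonormal too.
  Expanding the squared norm, only the diagonal terms survive.\<close>

lemma norm_beam_transform:
  fixes b :: "'m \<Rightarrow> complex ^ 'm"
  assumes "orthonormal_family b"
  shows "norm (beam_transform b v) = norm v"
proof -
  define B where "B = (\<chi> k j. b k $ j)"
  define B' where "B' = (\<chi> j k. cnj (b k $ j))"
  have "B ** B' = mat 1"
    using assms
    by (simp add: B_def B'_def matrix_matrix_mult_def mat_def vec_eq_iff orthonormal_family_def mult.commute)
  then have "B' ** B = mat 1"
    by (simp add: matrix_left_right_inverse)
  then have B'B: "(\<Sum>k\<in>UNIV. cnj (b k $ i) * b k $ j) = (if i = j then 1 else 0)" for i j
    by (simp add: B_def B'_def matrix_matrix_mult_def mat_def vec_eq_iff)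
  have "complex_of_real ((norm (beam_transform b v))\<^sup>2) =
      (\<Sum>k\<in>UNIV. cnj (\<Sum>i\<in>UNIV. v $ i * b k $ i) * (\<Sum>j\<in>UNIV. v $ j * b k $ j))"
    by (simp add: norm_vec_power2 complex_norm_square tdot_def mult.commute del: of_real_power)
  also have "\<dots> = (\<Sum>k\<in>UNIV. \<Sum>i\<in>UNIV. \<Sum>j\<in>UNIV. cnj (v $ i) * v $ j * (cnj (b k $ i) * b k $ j))"
    by (simp add: sum_product) (intro sum.cong refl, simp add: mult_ac)
  also have "\<dots> = (\<Sum>i\<in>UNIV. \<Sum>k\<in>UNIV. \<Sum>j\<in>UNIV. cnj (v $ i) * v $ j * (cnj (b k $ i) * b k $ j))"
    by (rule sum.swap)
  also have "\<dots> = (\<Sum>i\<in>UNIV. \<Sum>j\<in>UNIV. \<Sum>k\<in>UNIV. cnj (v $ i) * v $ j * (cnj (b k $ i) * b k $ j))"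
    by (intro sum.cong refl sum.swap)
  also have "\<dots> = (\<Sum>i\<in>UNIV. cnj (v $ i) * v $ i)"
    by (simp add: sum_distrib_left[symmetric] B'B if_distrib[of "\<lambda>x. _ * x"] cong: if_cong)
  also have "\<dots> = complex_of_real ((norm v)\<^sup>2)"
    by (simp add: norm_vec_power2 complex_norm_square mult.commute del: of_real_power)
  finally have "(norm (beam_transform b v))\<^sup>2 = (norm v)\<^sup>2"
    using of_real_eq_iff by blast
  then show ?thesis by simp
qed

lemma orthogonal_beam_transform:
  assumes "orthonormal_family b"
  shows "orthogonal_transformation (beam_transform b)"
  unfolding orthogonal_transformation
proof
  show "linear (beam_transform b)"
    by (rule linearI)
      (simp_all add: vec_eq_iff tdot_def algebra_simps sum.distrib scaleR_sum_right)
qed (simp add: norm_beam_transform[OF assms])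

context prob_space
begin

text \<open>Both ingredients of the law are invariant under an isometry: the density depends only on
  the norm, and Lebesgue measure is preserved.\<close>

lemma distr_gaussian_vector_beam_transform:
  fixes Z :: "'a \<Rightarrow> complex ^ 'n"
  assumes Z[measurable]: "random_variable borel Z"
    and indep: "indep_vars (\<lambda>_. borel) (\<lambda>j w. Z w $ j) UNIV"
    and gauss: "\<And>j. std_complex_gaussian (\<lambda>w. Z w $ j)"
    and b: "orthonormal_family b"
  shows "distr M borel (\<lambda>w. beam_transform b (Z w)) = distr M borel Z"
proof (rule measure_eqI)
  let ?T = "beam_transform b"
  let ?g = "\<lambda>v::complex ^ 'n. ennreal (exp (- (norm v)\<^sup>2) / sqrt pi ^ DIM(complex ^ 'n))"
  fix A assume "A \<in> sets (distr M borel (\<lambda>w. ?T (Z w)))"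
  then have A[measurable]: "A \<in> sets borel" by simp
  have law: "distr M borel Z = density lborel ?g"
    by (rule distr_gaussian_vector[OF Z indep gauss])
  have "emeasure (distr M borel (\<lambda>w. ?T (Z w))) A = emeasure (distr M borel Z) (?T -` A)"
    using measurable_sets[OF beam_transform_measurable A, of b]
    by (simp add: emeasure_distr vimage_def)
  \<comment> \<open>Replacing \<open>?g v\<close> by \<open>?g (?T v)\<close> makes the integrand a
    function of \<open>?T v\<close>, so that it can be integrated against the image measure.\<close>
  also have "\<dots> = (\<integral>\<^sup>+v. ?g (?T v) * indicator A (?T v) \<partial>lborel)"
    using measurable_sets[OF beam_transform_measurable A, of b]
    unfolding law by (simp add: emeasure_density norm_beam_transform[OF b] indicator_vimage)
  also have "\<dots> = (\<integral>\<^sup>+v. ?g v * indicator A v \<partial>distr lborel borel ?T)"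
    by (rule nn_integral_distr[symmetric]) measurable
  also have "\<dots> = emeasure (distr M borel Z) A"
    unfolding law by (simp add: distr_lborel_orthogonal[OF orthogonal_beam_transform[OF b]] emeasure_density)
  finally show "emeasure (distr M borel (\<lambda>w. ?T (Z w))) A = emeasure (distr M borel Z) A" .
qed simp

end

section \<open>The squared modulus of a complex Gaussian is exponential\<close>

lemma nn_integral_exp_shift:
  "(\<integral>\<^sup>+s. ennreal (exp (- s) * (s - t)) * indicator {t..} s \<partial>lborel) = ennreal (exp (- t))"
proof -
  have "(\<integral>\<^sup>+s. ennreal (exp (- s) * (s - t)) * indicator {t..} s \<partial>lborel) = ennreal (0 - - exp (- t) * (t - t + 1))"
  proof (rule nn_integral_FTC_atLeast[where F = "\<lambda>s. - exp (- s) * (s - t + 1)"])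
    show "((\<lambda>s. - exp (- s) * (s - t + 1)) \<longlongrightarrow> 0) at_top"
      by real_asymp
    show "((\<lambda>s. - exp (- s) * (s - t + 1)) has_real_derivative exp (- s) * (s - t)) (at s)" for s
      by (auto intro!: derivative_eq_intros simp: algebra_simps)
  qed auto
  then show ?thesis by simp
qed

lemma nn_integral_exp_atLeast:
  "(\<integral>\<^sup>+s. ennreal (exp (- s)) * indicator {t..} s \<partial>lborel) = ennreal (exp (- t))"
proof -
  have "(\<integral>\<^sup>+s. ennreal (exp (- s)) * indicator {t..} s \<partial>lborel) = ennreal (0 - - exp (- t))"
  proof (rule nn_integral_FTC_atLeast[where F = "\<lambda>s. - exp (- s)"])
    show "((\<lambda>s::real. - exp (- s)) \<longlongrightarrow> 0) at_top"
      by real_asymp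
    show "((\<lambda>s. - exp (- s)) has_real_derivative exp (- s)) (at s)" for s :: real
      by (auto intro!: derivative_eq_intros)
  qed auto
  then show ?thesis by simp
qed

text \<open>The layer-cake formula: writing \<open>exp (- |v|\<^sup>2)\<close> as an integral of \<open>exp (- s)\<close> over
  \<open>s \<ge> |v|\<^sup>2\<close> reduces the radial integral to areas of annuli.\<close>

lemma nn_integral_exp_norm_tail:
  assumes "0 \<le> t"
  shows "(\<integral>\<^sup>+v. ennreal (exp (- (norm v)\<^sup>2)) * indicator {v. t < (norm v)\<^sup>2} v \<partial>(lborel :: (real \<times> real) measure))
    = ennreal (pi * exp (- t))"
proof -
  have area: "emeasure lborel {v::real \<times> real. t < (norm v)\<^sup>2 \<and> (norm v)\<^sup>2 \<le> s} = ennreal (pi * (s - t))"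
    if "t \<le> s" for s
  proof -
    have "{v::real \<times> real. t < (norm v)\<^sup>2 \<and> (norm v)\<^sup>2 \<le> s} = cball 0 (sqrt s) - cball 0 (sqrt t)"
    proof -
      have "norm v \<le> sqrt r \<longleftrightarrow> (norm v)\<^sup>2 \<le> r" if "0 \<le> r" for r and v :: "real \<times> real"
        using that by (metis norm_ge_zero real_le_lsqrt real_sqrt_le_iff real_sqrt_unique sqrt_le_D)
      then show ?thesis
        using assms that by auto
    qed
    moreover have "cball 0 (sqrt t) \<subseteq> cball (0::real \<times> real) (sqrt s)"
      using that by (intro subset_cball) simp
    ultimately have "emeasure lborel {v::real \<times> real. t < (norm v)\<^sup>2 \<and> (norm v)\<^sup>2 \<le> s} =
       emeasure lborel (cball (0::real \<times> real) (sqrt s)) - emeasure lborel (cball (0::real \<times> real) (sqrt t))"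
      using assms by (subst emeasure_Diff[symmetric]) (auto simp: emeasure_cball)
    then show ?thesis
      using assms that by (simp add: emeasure_cball unit_ball_vol_2 ennreal_minus algebra_simps)
  qed
  have "(\<integral>\<^sup>+v. ennreal (exp (- (norm v)\<^sup>2)) * indicator {v. t < (norm v)\<^sup>2} v \<partial>(lborel :: (real \<times> real) measure))
    = (\<integral>\<^sup>+v. (\<integral>\<^sup>+s. ennreal (exp (- s)) * indicator {(norm v)\<^sup>2..} s * indicator {v. t < (norm v)\<^sup>2} v \<partial>lborel) \<partial>(lborel :: (real \<times> real) measure))"
    by (simp add: nn_integral_multc nn_integral_exp_atLeast)
  \<comment> \<open>The two constraints are put into one set of pairs, so that the integrand is
    visibly jointly measurable when the integrals are exchanged.\<close>
  also have "\<dots> = (\<integral>\<^sup>+v. (\<integral>\<^sup>+s. ennreal (exp (- s)) * indicator {p :: (real \<times> real) \<times> real. t < (norm (fst p))\<^sup>2 \<and> (norm (fst p))\<^sup>2 \<le> snd p} (v, s) \<partial>lborel) \<partial>lborel)"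
    by (intro nn_integral_cong) (auto simp: indicator_def)
  also have "\<dots> = (\<integral>\<^sup>+s. (\<integral>\<^sup>+v. ennreal (exp (- s)) * indicator {p :: (real \<times> real) \<times> real. t < (norm (fst p))\<^sup>2 \<and> (norm (fst p))\<^sup>2 \<le> snd p} (v, s) \<partial>lborel) \<partial>lborel)"
    by (rule lborel_pair.Fubini') measurable
  also have "\<dots> = (\<integral>\<^sup>+s. ennreal pi * (ennreal (exp (- s) * (s - t)) * indicator {t..} s) \<partial>lborel)"
  proof (rule nn_integral_cong)
    fix s :: real
    have eq: "indicator {p :: (real \<times> real) \<times> real. t < (norm (fst p))\<^sup>2 \<and> (norm (fst p))\<^sup>2 \<le> snd p} (v, s) =
      (indicator {v. t < (norm v)\<^sup>2 \<and> (norm v)\<^sup>2 \<le> s} v :: ennreal)" for v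
      by (simp add: indicator_def)
    have "(\<integral>\<^sup>+v. ennreal (exp (- s)) * indicator {p :: (real \<times> real) \<times> real. t < (norm (fst p))\<^sup>2 \<and> (norm (fst p))\<^sup>2 \<le> snd p} (v, s) \<partial>lborel)
      = ennreal (exp (- s)) * emeasure lborel {v::real \<times> real. t < (norm v)\<^sup>2 \<and> (norm v)\<^sup>2 \<le> s}"
      unfolding eq by (subst nn_integral_cmult_indicator) measurable
    also have "\<dots> = ennreal pi * (ennreal (exp (- s) * (s - t)) * indicator {t..} s)"
    proof (cases "t \<le> s")
      case True
      then show ?thesis by (simp add: area ennreal_mult'[symmetric] mult_ac)
    next
      case False
      then have "{v::real \<times> real. t < (norm v)\<^sup>2 \<and> (norm v)\<^sup>2 \<le> s} = {}" by force
      then show ?thesis using False by (simp only: emeasure_empty) simp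
    qed
    finally show "(\<integral>\<^sup>+v. ennreal (exp (- s)) * indicator {p :: (real \<times> real) \<times> real. t < (norm (fst p))\<^sup>2 \<and> (norm (fst p))\<^sup>2 \<le> snd p} (v, s) \<partial>lborel) =
      ennreal pi * (ennreal (exp (- s) * (s - t)) * indicator {t..} s)" .
  qed
  also have "\<dots> = ennreal (pi * exp (- t))"
    by (simp add: nn_integral_cmult nn_integral_exp_shift ennreal_mult)
  finally show ?thesis .
qed

context prob_space
begin

text \<open>Independent real and imaginary parts have the joint density exp(-|v|^2)/pi on the plane.
  Its mass where |v|^2 exceeds \<open>t\<close> is exp(-t), and these tails determine the
  law.\<close>

lemma std_complex_gaussian_norm_exponential:
  assumes "std_complex_gaussian Z"
  shows "distributed M lborel (\<lambda>w. (norm (Z w))\<^sup>2) (exponential_density 1)"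
proof -
  let ?nd = "normal_density 0 (sqrt (1 / 2))"
  have Z[measurable]: "random_variable borel Z"
    using assms by (simp add: std_complex_gaussian_def)
  have "distributed M (lborel \<Otimes>\<^sub>M lborel) (\<lambda>w. (Re (Z w), Im (Z w)))
      (\<lambda>(x, y). ennreal (?nd x) * ennreal (?nd y))"
  proof (rule distributed_joint_indep)
    show "indep_var lborel (\<lambda>w. Re (Z w)) lborel (\<lambda>w. Im (Z w))"
      using assms by (simp add: std_complex_gaussian_def indep_var_eq)
  qed (use assms in \<open>auto simp: std_complex_gaussian_def intro: sigma_finite_lborel\<close>)
  moreover have "ennreal (?nd x) * ennreal (?nd y) = ennreal (1 / pi) * ennreal (exp (- (norm (x, y))\<^sup>2))" for x y
    by (simp add: normal_density_def norm_Pair real_sqrt_divide power_divide ennreal_mult'[symmetric] exp_add[symmetric] real_sqrt_mult[symmetric] add.commute)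
  ultimately have joint: "distributed M (lborel :: (real \<times> real) measure) (\<lambda>w. (Re (Z w), Im (Z w)))
      (\<lambda>v. ennreal (1 / pi) * ennreal (exp (- (norm v)\<^sup>2)))"
    by (simp add: lborel_prod split_def)
  have norm_eq: "norm (Re z, Im z) = norm z" for z
    by (simp add: norm_Pair cmod_def)
  have tail: "prob {w\<in>space M. t < (norm (Z w))\<^sup>2} = exp (- t)" if "0 \<le> t" for t
  proof -
    have [measurable]: "{v :: real \<times> real. t < (norm v)\<^sup>2} \<in> sets borel" by measurable
    have "emeasure M ((\<lambda>w. (Re (Z w), Im (Z w))) -` {v. t < (norm v)\<^sup>2} \<inter> space M) =
        (\<integral>\<^sup>+v. ennreal (1 / pi) * ennreal (exp (- (norm v)\<^sup>2)) * indicator {v :: real \<times> real. t < (norm v)\<^sup>2} v \<partial>lborel)"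
      by (rule distributed_emeasure[OF joint]) simp
    also have "\<dots> = ennreal (1 / pi) *
        (\<integral>\<^sup>+v. ennreal (exp (- (norm v)\<^sup>2)) * indicator {v :: real \<times> real. t < (norm v)\<^sup>2} v \<partial>lborel)"
      unfolding mult.assoc by (rule nn_integral_cmult) measurable
    also have "\<dots> = ennreal (exp (- t))"
      by (simp add: nn_integral_exp_norm_tail[OF that] ennreal_mult'[symmetric])
    finally show ?thesis
      by (simp add: emeasure_eq_measure vimage_def Int_def conj_commute norm_eq)
  qed
  show ?thesis
    unfolding exponential_distributed_iff[OF zero_less_one]
  proof safe
    fix t :: real assume t: "0 \<le> t"
    have "{w\<in>space M. (norm (Z w))\<^sup>2 \<le> t} = space M - {w\<in>space M. t < (norm (Z w))\<^sup>2}" by auto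
    then show "prob {w\<in>space M. (norm (Z w))\<^sup>2 \<le> t} = 1 - exp (- t * 1)"
      by (simp add: prob_compl tail[OF t])
  qed measurable
qed

text \<open>Tilting the density of rate 1 by exp(-yt) gives the density of rate 1 + y up to the
  factor 1/(1 + y), and a density has total mass 1.\<close>

lemma exponential_laplace:
  assumes "distributed M lborel E (exponential_density 1)" and "0 \<le> y"
  shows "(\<integral>\<^sup>+w. ennreal (exp (- y * E w)) \<partial>M) = ennreal (1 / (1 + y))"
proof -
  have "(\<integral>\<^sup>+w. ennreal (exp (- y * E w)) \<partial>M) =
      (\<integral>\<^sup>+t. ennreal (exponential_density 1 t) * ennreal (exp (- y * t)) \<partial>lborel)"
    by (rule distributed_nn_integral[OF assms(1), symmetric]) measurable
  also have "\<dots> = (\<integral>\<^sup>+t. ennreal (1 / (1 + y)) * ennreal (exponential_density (1 + y) t) \<partial>lborel)"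
    using assms(2)
    by (intro nn_integral_cong)
      (auto simp: exponential_density_def ennreal_mult'[symmetric] exp_add[symmetric] field_simps distrib_left[symmetric])
  also have "\<dots> = ennreal (1 / (1 + y))"
  proof -
    interpret E: prob_space "density lborel (exponential_density (1 + y))"
      using assms(2) by (intro prob_space_exponential_density) simp
    have "(\<integral>\<^sup>+t. ennreal (exponential_density (1 + y) t) \<partial>lborel) = 1"
      using E.emeasure_space_1 by (simp add: emeasure_density)
    then show ?thesis by (simp add: nn_integral_cmult)
  qed
  finally show ?thesis .
qed

end

section \<open>The SINR of a single user\<close>

context prob_space
begin

text \<open>Independence determines the joint law on measurable rectangles, hence everywhere. The
  product form is what allows Fubini arguments for random elements of different types.\<close>

lemma indep_rv_distr:
  assumes "indep_rv N1 Z1 N2 Z2"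
  shows "distr M (N1 \<Otimes>\<^sub>M N2) (\<lambda>w. (Z1 w, Z2 w)) = distr M N1 Z1 \<Otimes>\<^sub>M distr M N2 Z2"
proof -
  have [measurable]: "random_variable N1 Z1" "random_variable N2 Z2"
    and ind: "indep_set {Z1 -` A \<inter> space M | A. A \<in> sets N1} {Z2 -` A \<inter> space M | A. A \<in> sets N2}"
    using assms by (auto simp: indep_rv_def)
  interpret D1: prob_space "distr M N1 Z1" by (rule prob_space_distr) measurable
  interpret D2: prob_space "distr M N2 Z2" by (rule prob_space_distr) measurable
  show ?thesis
  proof (rule pair_measure_eqI[symmetric])
    fix A B assume "A \<in> sets (distr M N1 Z1)" "B \<in> sets (distr M N2 Z2)"
    then have A[measurable]: "A \<in> sets N1" and B[measurable]: "B \<in> sets N2" by auto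
    have "prob ((Z1 -` A \<inter> space M) \<inter> (Z2 -` B \<inter> space M)) = prob (Z1 -` A \<inter> space M) * prob (Z2 -` B \<inter> space M)"
      using A B by (intro indep_setD[OF ind]) auto
    moreover have "(\<lambda>w. (Z1 w, Z2 w)) -` (A \<times> B) \<inter> space M = (Z1 -` A \<inter> space M) \<inter> (Z2 -` B \<inter> space M)"
      by auto
    ultimately show "emeasure (distr M N1 Z1) A * emeasure (distr M N2 Z2) B =
        emeasure (distr M (N1 \<Otimes>\<^sub>M N2) (\<lambda>w. (Z1 w, Z2 w))) (A \<times> B)"
      by (simp add: emeasure_distr emeasure_eq_measure ennreal_mult)
  qed (simp_all add: D1.sigma_finite_measure_axioms D2.sigma_finite_measure_axioms)
qed

text \<open>Given \<open>V = v\<close>, the exceedance probability is the exponential tail exp(-v),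
  valid since \<open>v\<close> is nonnegative; Fubini on the product law averages it over
  \<open>V\<close>.\<close>

lemma exponential_exceeds_indep:
  assumes E: "distributed M lborel E (exponential_density 1)"
    and indep: "indep_var borel E borel V"
    and V: "\<And>w. w \<in> space M \<Longrightarrow> 0 \<le> V w"
  shows "emeasure M {w\<in>space M. V w < E w} = (\<integral>\<^sup>+w. ennreal (exp (- V w)) \<partial>M)"
proof -
  have [measurable]: "random_variable borel E" "random_variable borel V"
    using indep by (auto dest: indep_var_rv1 indep_var_rv2)
  have joint: "distr M (borel \<Otimes>\<^sub>M borel) (\<lambda>w. (E w, V w)) = distr M borel E \<Otimes>\<^sub>M distr M borel V"
    using indep_var_distribution_eq[of borel E borel V] indep by simp
  interpret DE: prob_space "distr M borel E" by (rule prob_space_distr) measurable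
  interpret DV: prob_space "distr M borel V" by (rule prob_space_distr) measurable
  interpret D: pair_sigma_finite "distr M borel E" "distr M borel V" ..
  have tail: "emeasure (distr M borel E) {v<..} = ennreal (exp (- v))" if "0 \<le> v" for v
    using exponential_distributedD_gt[OF E that zero_less_one]
    by (simp add: emeasure_distr emeasure_eq_measure vimage_def Int_def conj_commute)
  have S[measurable]: "{p :: real \<times> real. snd p < fst p} \<in> sets (borel \<Otimes>\<^sub>M borel)"
    unfolding borel_prod by (intro borel_open open_Collect_less continuous_intros)
  have "{w\<in>space M. V w < E w} = (\<lambda>w. (E w, V w)) -` {p. snd p < fst p} \<inter> space M" by auto
  then have "emeasure M {w\<in>space M. V w < E w} =
      emeasure (distr M (borel \<Otimes>\<^sub>M borel) (\<lambda>w. (E w, V w))) {p. snd p < fst p}"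
    by (subst emeasure_distr[OF _ S]) simp_all
  also have "\<dots> = (\<integral>\<^sup>+v. emeasure (distr M borel E) ((\<lambda>e. (e, v)) -` {p. snd p < fst p}) \<partial>distr M borel V)"
    unfolding joint by (rule D.emeasure_pair_measure_alt2) measurable
  also have "\<dots> = (\<integral>\<^sup>+v. emeasure (distr M borel E) {v<..} \<partial>distr M borel V)"
    by (simp add: vimage_def greaterThan_def)
  also have "\<dots> = (\<integral>\<^sup>+w. emeasure (distr M borel E) {V w<..} \<partial>M)"
  proof (intro nn_integral_distr)
    have "{p :: real \<times> real. fst p < snd p} \<in> sets (borel \<Otimes>\<^sub>M borel)"
      unfolding borel_prod by (intro borel_open open_Collect_less continuous_intros)
    then have "{p :: real \<times> real. fst p < snd p} \<in> sets (distr M borel V \<Otimes>\<^sub>M distr M borel E)"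
      using sets_pair_measure_cong[of "distr M borel V" borel "distr M borel E" borel] by simp
    from DE.measurable_emeasure_Pair[OF this]
    show "(\<lambda>v. emeasure (distr M borel E) {v<..}) \<in> borel_measurable (distr M borel V)"
      by (simp add: vimage_def greaterThan_def)
  qed measurable
  also have "\<dots> = (\<integral>\<^sup>+w. ennreal (exp (- V w)) \<partial>M)"
    by (intro nn_integral_cong) (simp add: tail V)
  finally show ?thesis .
qed

text \<open>The power of coordinate \<open>m\<close> is an exponential variable independent of the
  interference. Conditioning on the latter leaves the expectation of exp(-V) with V = y (c + sum),
  which splits into exp(-yc) and one Laplace transform 1/(1 + y) for each of the
  \<open>CARD('n) - 1\<close> interfering coordinates.\<close>

lemma gaussian_vector_sinr_tail:
  fixes Z :: "'a \<Rightarrow> complex ^ 'n" and m :: 'n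
  assumes Z[measurable]: "random_variable borel Z"
    and indep: "indep_vars (\<lambda>_. borel) (\<lambda>j w. Z w $ j) UNIV"
    and gauss: "\<And>j. std_complex_gaussian (\<lambda>w. Z w $ j)"
    and y: "0 \<le> y" and c: "0 \<le> c"
  shows "prob {w\<in>space M. y * (c + (\<Sum>k\<in>UNIV - {m}. (norm (Z w $ k))\<^sup>2)) < (norm (Z w $ m))\<^sup>2} =
    exp (- y * c) / (1 + y) ^ (CARD('n) - 1)"
proof -
  let ?E = "\<lambda>k w. (norm (Z w $ k))\<^sup>2"
  have E: "distributed M lborel (?E k) (exponential_density 1)" for k
    by (rule std_complex_gaussian_norm_exponential[OF gauss])
  have [measurable]: "(\<lambda>w. Z w $ k) \<in> borel_measurable M" for k
    using gauss by (simp add: std_complex_gaussian_def)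
  have indE: "indep_vars (\<lambda>_. borel) ?E UNIV"
    by (rule indep_vars_compose2[OF indep]) measurable
  have "indep_var borel (?E m) borel (\<lambda>w. \<Sum>k\<in>UNIV - {m}. ?E k w)"
    by (rule indep_vars_sum) (auto simp: insert_absorb indE)
  then have "indep_var borel ((\<lambda>s. s) \<circ> ?E m) borel ((\<lambda>s. y * (c + s)) \<circ> (\<lambda>w. \<Sum>k\<in>UNIV - {m}. ?E k w))"
    by (rule indep_var_compose) measurable
  then have ind: "indep_var borel (?E m) borel (\<lambda>w. y * (c + (\<Sum>k\<in>UNIV - {m}. ?E k w)))"
    by (simp add: comp_def)
  have "emeasure M {w\<in>space M. y * (c + (\<Sum>k\<in>UNIV - {m}. ?E k w)) < ?E m w} =
      (\<integral>\<^sup>+w. ennreal (exp (- (y * (c + (\<Sum>k\<in>UNIV - {m}. ?E k w))))) \<partial>M)"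
    using y c by (intro exponential_exceeds_indep[OF E ind]) (simp add: sum_nonneg)
  also have "\<dots> = (\<integral>\<^sup>+w. ennreal (exp (- y * c)) * (\<Prod>k\<in>UNIV - {m}. ennreal (exp (- y * ?E k w))) \<partial>M)"
    by (intro nn_integral_cong)
      (simp add: prod_ennreal ennreal_mult'[symmetric] exp_sum[symmetric] exp_add[symmetric] sum_negf sum_distrib_left distrib_left)
  also have "\<dots> = ennreal (exp (- y * c)) * (\<integral>\<^sup>+w. (\<Prod>k\<in>UNIV - {m}. ennreal (exp (- y * ?E k w))) \<partial>M)"
    by (rule nn_integral_cmult) measurable
  also have "(\<integral>\<^sup>+w. (\<Prod>k\<in>UNIV - {m}. ennreal (exp (- y * ?E k w))) \<partial>M) =
      (\<Prod>k\<in>UNIV - {m}. \<integral>\<^sup>+w. ennreal (exp (- y * ?E k w)) \<partial>M)"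
  proof (rule indep_vars_nn_integral)
    show "indep_vars (\<lambda>_. borel) (\<lambda>k w. ennreal (exp (- y * ?E k w))) (UNIV - {m})"
      by (rule indep_vars_compose2[OF indep_vars_subset[OF indE]]) measurable
  qed auto
  also have "\<dots> = ennreal ((1 / (1 + y)) ^ (CARD('n) - 1))"
    using y by (simp add: exponential_laplace[OF E y, simplified] card_Diff_singleton ennreal_power)
  finally show ?thesis
    using y by (simp add: emeasure_eq_measure ennreal_mult'[symmetric] power_divide)
qed

text \<open>The event depends on \<open>Z\<close> only through \<open>beam_transform b\<close>,
  whose value has the same law as \<open>Z\<close>; the projections onto the beams may thus be
  replaced by the plain coordinates.\<close>

lemma gaussian_vector_beam_sinr_tail:
  fixes Z :: "'a \<Rightarrow> complex ^ 'n" and m :: 'n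
  assumes Z[measurable]: "random_variable borel Z"
    and indep: "indep_vars (\<lambda>_. borel) (\<lambda>j w. Z w $ j) UNIV"
    and gauss: "\<And>j. std_complex_gaussian (\<lambda>w. Z w $ j)"
    and b: "orthonormal_family b"
    and y: "0 \<le> y" and c: "0 \<le> c"
  shows "prob {w\<in>space M. y * (c + (\<Sum>k\<in>UNIV - {m}. (norm (tdot (Z w) (b k)))\<^sup>2)) < (norm (tdot (Z w) (b m)))\<^sup>2} =
    exp (- y * c) / (1 + y) ^ (CARD('n) - 1)"
proof -
  define A where "A = {v :: complex ^ 'n. y * (c + (\<Sum>k\<in>UNIV - {m}. (norm (v $ k))\<^sup>2)) < (norm (v $ m))\<^sup>2}"
  have "open A"
    unfolding A_def by (intro open_Collect_less continuous_intros)
  then have "A \<in> sets borel" by simp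
  have "prob {w\<in>space M. y * (c + (\<Sum>k\<in>UNIV - {m}. (norm (tdot (Z w) (b k)))\<^sup>2)) < (norm (tdot (Z w) (b m)))\<^sup>2}
    = measure (distr M borel (\<lambda>w. beam_transform b (Z w))) A"
    by (subst measure_distr[OF _ \<open>A \<in> sets borel\<close>]) (auto simp: A_def intro!: arg_cong[where f=prob])
  also have "\<dots> = prob {w\<in>space M. y * (c + (\<Sum>k\<in>UNIV - {m}. (norm (Z w $ k))\<^sup>2)) < (norm (Z w $ m))\<^sup>2}"
    unfolding distr_gaussian_vector_beam_transform[OF Z indep gauss b]
    by (subst measure_distr[OF _ \<open>A \<in> sets borel\<close>]) (auto simp: A_def intro!: arg_cong[where f=prob])
  finally show ?thesis
    by (simp add: gaussian_vector_sinr_tail[OF Z indep gauss y c])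
qed

end

section \<open>The generating functional of a Poisson process\<close>

text \<open>Summing the Poisson weights times a^k is an exponential series in \<mu> a.\<close>

lemma poisson_generating_function:
  fixes N :: "'a \<Rightarrow> nat"
  assumes "prob_space M" and N[measurable]: "N \<in> measurable M (count_space UNIV)"
    and pois: "\<And>k. measure M {w\<in>space M. N w = k} = exp (- \<mu>) * \<mu> ^ k / fact k"
    and a: "0 \<le> a" and \<mu>: "0 \<le> \<mu>"
  shows "(\<integral>\<^sup>+w. ennreal (a ^ N w) \<partial>M) = ennreal (exp (- (\<mu> * (1 - a))))"
proof -
  interpret prob_space M by fact
  have "(\<integral>\<^sup>+w. ennreal (a ^ N w) \<partial>M) = (\<integral>\<^sup>+k. ennreal (a ^ k) \<partial>distr M (count_space UNIV) N)"
    by (rule nn_integral_distr[symmetric]) measurable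
  also have "distr M (count_space UNIV) N = density (count_space UNIV) (\<lambda>k. ennreal (exp (- \<mu>) * \<mu> ^ k / fact k))"
  proof (rule measure_eqI_countable)
    fix k :: nat
    show "emeasure (distr M (count_space UNIV) N) {k} =
        emeasure (density (count_space UNIV) (\<lambda>k. ennreal (exp (- \<mu>) * \<mu> ^ k / fact k))) {k}"
      using pois[of k]
      by (simp add: emeasure_distr emeasure_density emeasure_eq_measure vimage_def Int_def conj_commute)
  qed auto
  also have "(\<integral>\<^sup>+k. ennreal (a ^ k) \<partial>density (count_space UNIV) (\<lambda>k. ennreal (exp (- \<mu>) * \<mu> ^ k / fact k))) =
      (\<Sum>k. ennreal (exp (- \<mu>) * ((\<mu> * a) ^ k /\<^sub>R fact k)))"
    using a \<mu>
    by (simp add: nn_integral_density nn_integral_count_space_nat ennreal_mult'[symmetric]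
        power_mult_distrib divide_inverse mult_ac)
  also have "\<dots> = ennreal (exp (- \<mu>) * exp (\<mu> * a))"
    using a \<mu> by (intro suminf_ennreal_eq sums_mult exp_converges) simp
  also have "exp (- \<mu>) * exp (\<mu> * a) = exp (- (\<mu> * (1 - a)))"
    by (simp add: exp_add[symmetric] algebra_simps)
  finally show ?thesis .
qed

lemma measure_cball_plane:
  "0 \<le> r \<Longrightarrow> measure lborel (cball 0 r :: plane set) = pi * r\<^sup>2"
  by (simp add: content_cball unit_ball_vol_2)

context prob_space
begin

lemma ppp_locally_finite:
  assumes "homogeneous_ppp lam X" "w \<in> space M" "bounded A"
  shows "finite {i. X i w \<in> A}"
  using assms by (simp add: homogeneous_ppp_def)

text \<open>This is the generating functional for step functions: each point in \<open>A j\<close>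
  contributes the factor \<open>a j\<close>. Counts on disjoint sets are independent, so the
  expectation is a product of Poisson generating functions.\<close>

lemma ppp_product_over_partition:
  fixes A :: "nat \<Rightarrow> plane set"
  assumes ppp: "homogeneous_ppp lam X" and lam: "0 \<le> lam"
    and I: "finite I" "disjoint_family_on A I"
    and A: "\<And>j. j \<in> I \<Longrightarrow> A j \<in> sets borel" "\<And>j. j \<in> I \<Longrightarrow> bounded (A j)"
    and a: "\<And>j. j \<in> I \<Longrightarrow> 0 \<le> a j"
  shows "(\<integral>\<^sup>+w. (\<Prod>j\<in>I. ennreal (a j ^ count_in X (A j) w)) \<partial>M) =
    ennreal (exp (- lam * (\<Sum>j\<in>I. measure lborel (A j) * (1 - a j))))"
proof -
  have ind: "indep_vars (\<lambda>_. count_space UNIV) (\<lambda>j. count_in X (A j)) I"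
    using ppp I A by (simp add: homogeneous_ppp_def)
  have "(\<integral>\<^sup>+w. (\<Prod>j\<in>I. ennreal (a j ^ count_in X (A j) w)) \<partial>M) =
      (\<Prod>j\<in>I. \<integral>\<^sup>+w. ennreal (a j ^ count_in X (A j) w) \<partial>M)"
  proof (rule indep_vars_nn_integral[OF I(1)])
    show "indep_vars (\<lambda>_. borel) (\<lambda>j w. ennreal (a j ^ count_in X (A j) w)) I"
      by (rule indep_vars_compose2[OF ind]) simp
  qed auto
  also have "\<dots> = (\<Prod>j\<in>I. ennreal (exp (- (lam * measure lborel (A j) * (1 - a j)))))"
  proof (rule prod.cong[OF refl])
    fix j assume j: "j \<in> I"
    show "(\<integral>\<^sup>+w. ennreal (a j ^ count_in X (A j) w) \<partial>M) = ennreal (exp (- (lam * measure lborel (A j) * (1 - a j))))"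
    proof (rule poisson_generating_function[OF prob_space_axioms])
      show "random_variable (count_space UNIV) (count_in X (A j))"
        using ind j by (simp add: indep_vars_def)
      show "prob {w \<in> space M. count_in X (A j) w = k} =
          exp (- (lam * measure lborel (A j))) * (lam * measure lborel (A j)) ^ k / fact k" for k
        using ppp A[OF j] by (simp add: homogeneous_ppp_def)
    qed (use j a lam in auto)
  qed
  also have "\<dots> = ennreal (exp (- lam * (\<Sum>j\<in>I. measure lborel (A j) * (1 - a j))))"
    by (simp add: prod_ennreal exp_sum[OF I(1), symmetric] sum_negf sum_distrib_left mult_ac)
  finally show ?thesis .
qed

end

text \<open>On each interval of length \<open>d\<close> a decreasing function lies between its right
  and left endpoint values; continuity provides integrability, and the intervals are added up by
  induction.\<close>

lemma antimono_riemann_sums: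
  fixes Q :: "real \<Rightarrow> real"
  assumes cont: "continuous_on {0..} Q" and anti: "antimono_on {0..} Q" and d: "0 \<le> d"
  shows "(\<Sum>j<k. d * Q (d * real (Suc j))) \<le> integral {0..d * real k} Q"
    and "integral {0..d * real k} Q \<le> (\<Sum>j<k. d * Q (d * real j))"
proof -
  have int: "Q integrable_on {u..v}" if "0 \<le> u" for u v
    using that by (intro integrable_continuous_real continuous_on_subset[OF cont]) auto
  have le: "Q t \<le> Q s" if "0 \<le> s" "s \<le> t" for s t
    using anti that by (auto simp: monotone_on_def)
  have split: "integral {0..d * real (Suc k)} Q = integral {0..d * real k} Q + integral {d * real k..d * real (Suc k)} Q" for k
  proof -
    have "d * real k \<le> d * real (Suc k)" "0 \<le> d * real k" using d by (auto intro!: mult_left_mono)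
    then show ?thesis by (intro Henstock_Kurzweil_Integration.integral_combine[symmetric] int) auto
  qed
  have step: "d * Q (d * real (Suc k)) \<le> integral {d * real k..d * real (Suc k)} Q"
    "integral {d * real k..d * real (Suc k)} Q \<le> d * Q (d * real k)" for k
  proof -
    have nn: "0 \<le> d * real k" using d by simp
    have len: "d * real k \<le> d * real (Suc k)" using d by (intro mult_left_mono) auto
    have "integral {d * real k..d * real (Suc k)} (\<lambda>_. Q (d * real (Suc k))) \<le> integral {d * real k..d * real (Suc k)} Q"
      using nn by (intro integral_le int) (auto intro!: le intro: order_trans[OF nn])
    then show "d * Q (d * real (Suc k)) \<le> integral {d * real k..d * real (Suc k)} Q"
      using len by (simp add: algebra_simps)
    have "integral {d * real k..d * real (Suc k)} Q \<le> integral {d * real k..d * real (Suc k)} (\<lambda>_. Q (d * real k))"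
      using nn by (intro integral_le int) (auto intro!: le)
    then show "integral {d * real k..d * real (Suc k)} Q \<le> d * Q (d * real k)"
      using len by (simp add: algebra_simps)
  qed
  show "(\<Sum>j<k. d * Q (d * real (Suc j))) \<le> integral {0..d * real k} Q"
  proof (induction k)
    case (Suc k)
    then show ?case using step(1)[of k] by (simp only: split sum.lessThan_Suc)
  qed simp
  show "integral {0..d * real k} Q \<le> (\<Sum>j<k. d * Q (d * real j))"
  proof (induction k)
    case (Suc k)
    then show ?case using step(2)[of k] by (simp only: split sum.lessThan_Suc)
  qed simp
qed

context prob_space
begin

text \<open>\<open>Q\<close> is taken as a function of the squared radius because area then becomes
  pi ds, which explains the factor pi and the upper limit \<open>D\<^sup>2\<close>. As
  \<open>Q\<close> decreases, its extreme values on an annulus are bounded by those on the two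
  bounding circles, which squeezes the product over users between two step-function products.
  Monotonicity of the integral suffices for this comparison.\<close>

lemma ppp_radial_generating_functional:
  assumes ppp: "homogeneous_ppp lam X" and lam: "0 \<le> lam" and D: "0 < D"
    and cont: "continuous_on {0..} Q" and anti: "antimono_on {0..} Q"
    and Q: "\<And>s. 0 \<le> s \<Longrightarrow> 0 \<le> Q s" "\<And>s. 0 \<le> s \<Longrightarrow> Q s \<le> 1"
  shows "(\<integral>\<^sup>+w. (\<Prod>i\<in>users_in_cell D X w. ennreal (1 - Q ((norm (X i w))\<^sup>2))) \<partial>M) =
    ennreal (exp (- lam * pi * integral {0..D\<^sup>2} Q))"
    (is "?E = ennreal (exp (- lam * pi * ?I))")
proof -
  define u where "u w = (\<Prod>i\<in>users_in_cell D X w. 1 - Q ((norm (X i w))\<^sup>2))" for w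
  have le: "Q t \<le> Q s" if "0 \<le> s" "s \<le> t" for s t
    using anti that by (auto simp: monotone_on_def)
  have E: "?E = (\<integral>\<^sup>+w. ennreal (u w) \<partial>M)"
    unfolding u_def using Q(2) by (intro nn_integral_cong prod_ennreal) simp
  have bounds: "ennreal (exp (- lam * pi * (?I + D\<^sup>2 / real n))) \<le> ?E \<and>
      ?E \<le> ennreal (exp (- lam * pi * (?I - D\<^sup>2 / real n)))" if n: "n > 0" for n :: nat
  proof -
    txt \<open>The annuli \<open>A 1, \<dots>, A n\<close> have equal areas, so that the bounds are Riemann sums in the squared radius.\<close>
    define d where "d = D\<^sup>2 / real n"
    have d: "0 < d" using D n by (simp add: d_def)
    have dn: "d * real n = D\<^sup>2" using n by (simp add: d_def)
    define C :: "nat \<Rightarrow> plane set" where "C j = cball 0 (sqrt (d * real j))" for j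
    define A where "A = disjointed C"
    have "mono C"
      using d by (auto simp: mono_def C_def intro!: subset_cball mult_left_mono)
    then have A_Suc: "A (Suc j) = C (Suc j) - C j" for j
      unfolding A_def by (rule disjointed_mono)
    \<comment> \<open>\<open>C 0\<close> is a ball of radius 0. The origin is kept as a null piece
      so that the pieces cover the whole closed disk.\<close>
    have A_0: "A 0 = {0}"
      by (simp add: A_def disjointed_0 C_def)
    have C_iff: "x \<in> C j \<longleftrightarrow> (norm x)\<^sup>2 \<le> d * real j" for x j
    proof -
      have "norm x \<le> sqrt (d * real j) \<longleftrightarrow> sqrt ((norm x)\<^sup>2) \<le> sqrt (d * real j)" by simp
      then show ?thesis by (simp only: C_def mem_cball_0 real_sqrt_le_iff)
    qed
    have A_borel: "A j \<in> sets borel" for j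
      by (cases j) (simp_all add: A_0 A_Suc C_def)
    have A_bounded: "bounded (A j)" for j
      by (cases j) (auto simp: A_0 A_Suc C_def intro: bounded_subset[OF bounded_cball])
    have disj: "disjoint_family_on A {..n}"
      using disjoint_family_disjointed[of C] by (auto simp: A_def disjoint_family_on_def)
    have A_measure: "measure lborel (A j) = (if j = 0 then 0 else pi * d)" for j
    proof (cases j)
      case (Suc k)
      have "measure lborel (C (Suc k) - C k) = measure lborel (C (Suc k)) - measure lborel (C k)"
        using monoD[OF \<open>mono C\<close>, of k "Suc k"] emeasure_bounded_finite[of "C (Suc k)"]
        by (intro measure_Diff) (auto simp: C_def)
      then show ?thesis
        using d by (simp add: Suc A_Suc C_def measure_cball_plane algebra_simps)
    qed (simp add: A_0)
    have C_n: "C n = cball 0 D"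
      using D by (simp add: C_def dn)
    have C_le: "C j \<subseteq> C n" if "j < Suc n" for j
      using that by (intro monoD[OF \<open>mono C\<close>]) simp
    have A_cover: "(\<Union>j\<in>{..n}. A j) = cball 0 D"
    proof -
      have "(\<Union>j\<in>{0..<Suc n}. A j) = (\<Union>j\<in>{0..<Suc n}. C j)"
        unfolding A_def by (rule finite_UN_disjointed_eq)
      moreover have "(\<Union>j\<in>{0..<Suc n}. C j) = C n"
      proof
        show "C n \<subseteq> (\<Union>j\<in>{0..<Suc n}. C j)" by (rule UN_upper) simp
        show "(\<Union>j\<in>{0..<Suc n}. C j) \<subseteq> C n" by (rule UN_least) (simp add: C_le)
      qed
      ultimately show ?thesis
        unfolding C_n by (simp only: atLeast0LessThan lessThan_Suc_atMost)
    qed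
    \<comment> \<open>The subtraction is truncated: for \<open>j = 0\<close> both bounds are 0, in
      agreement with \<open>A 0 = {0}\<close>.\<close>
    have ring: "d * real (j - 1) \<le> (norm x)\<^sup>2 \<and> (norm x)\<^sup>2 \<le> d * real j" if "x \<in> A j" for x j
    proof (cases j)
      case 0
      then show ?thesis using that by (simp add: A_0)
    next
      case (Suc k)
      then show ?thesis using that unfolding Suc A_Suc Diff_iff C_iff by simp
    qed
    have u: "u w = (\<Prod>j\<le>n. \<Prod>i | X i w \<in> A j. 1 - Q ((norm (X i w))\<^sup>2))" if w: "w \<in> space M" for w
    proof -
      have "finite {i. X i w \<in> A j}" for j
        by (rule ppp_locally_finite[OF ppp w A_bounded])
      moreover have "users_in_cell D X w = (\<Union>j\<in>{..n}. {i. X i w \<in> A j})"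
        unfolding users_in_cell_def A_cover[symmetric] by auto
      ultimately show ?thesis
        unfolding u_def using disj
        by (simp only:) (intro prod.UNION_disjoint, auto simp: disjoint_family_on_def; blast)
    qed
    have nonneg: "0 \<le> 1 - Q (d * real j)" "0 \<le> 1 - Q ((norm x)\<^sup>2)" for j and x :: plane
      using Q(2) d by simp_all
    have sandwich: "(\<Prod>j\<le>n. (1 - Q (d * real (j - 1))) ^ count_in X (A j) w) \<le> u w"
      "u w \<le> (\<Prod>j\<le>n. (1 - Q (d * real j)) ^ count_in X (A j) w)" if w: "w \<in> space M" for w
    proof -
      have low: "1 - Q (d * real (j - 1)) \<le> 1 - Q ((norm x)\<^sup>2)"
        and up: "1 - Q ((norm x)\<^sup>2) \<le> 1 - Q (d * real j)" if "x \<in> A j" for x j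
        using ring[OF that] d by (auto intro!: le)
      have "(1 - Q (d * real (j - 1))) ^ count_in X (A j) w \<le> (\<Prod>i | X i w \<in> A j. 1 - Q ((norm (X i w))\<^sup>2))" for j
      proof -
        have "(\<Prod>i | X i w \<in> A j. 1 - Q (d * real (j - 1))) \<le> (\<Prod>i | X i w \<in> A j. 1 - Q ((norm (X i w))\<^sup>2))"
          by (rule prod_mono) (use nonneg low in blast)
        then show ?thesis by (simp add: count_in_def)
      qed
      then show "(\<Prod>j\<le>n. (1 - Q (d * real (j - 1))) ^ count_in X (A j) w) \<le> u w"
        unfolding u[OF w] using zero_le_power[OF nonneg(1)] by (intro prod_mono) blast
      have "(\<Prod>i | X i w \<in> A j. 1 - Q ((norm (X i w))\<^sup>2)) \<le> (1 - Q (d * real j)) ^ count_in X (A j) w" for j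
      proof -
        have "(\<Prod>i | X i w \<in> A j. 1 - Q ((norm (X i w))\<^sup>2)) \<le> (\<Prod>i | X i w \<in> A j. 1 - Q (d * real j))"
          by (rule prod_mono) (use nonneg up in blast)
        then show ?thesis by (simp add: count_in_def)
      qed
      moreover have "0 \<le> (\<Prod>i | X i w \<in> A j. 1 - Q ((norm (X i w))\<^sup>2))" for j
        by (rule prod_nonneg) (use nonneg(2) in blast)
      ultimately show "u w \<le> (\<Prod>j\<le>n. (1 - Q (d * real j)) ^ count_in X (A j) w)"
        unfolding u[OF w] by (intro prod_mono) blast
    qed
    \<comment> \<open>The map \<open>f\<close> selects the circle at which \<open>Q\<close> is
      evaluated: \<open>j - 1\<close> is the inner one and gives the left-endpoint sum,
      \<open>j\<close> the outer one and gives the right-endpoint sum. The term of the null set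
      \<open>A 0\<close> vanishes, which shifts the summation index by one.\<close>
    have step: "(\<integral>\<^sup>+w. ennreal (\<Prod>j\<le>n. (1 - Q (d * real (f j))) ^ count_in X (A j) w) \<partial>M) =
        ennreal (exp (- lam * pi * (\<Sum>j<n. d * Q (d * real (f (Suc j))))))" for f :: "nat \<Rightarrow> nat"
    proof -
      have "(\<integral>\<^sup>+w. ennreal (\<Prod>j\<le>n. (1 - Q (d * real (f j))) ^ count_in X (A j) w) \<partial>M) =
          (\<integral>\<^sup>+w. (\<Prod>j\<le>n. ennreal ((1 - Q (d * real (f j))) ^ count_in X (A j) w)) \<partial>M)"
        by (intro nn_integral_cong prod_ennreal[symmetric] zero_le_power nonneg)
      also have "\<dots> = ennreal (exp (- lam * (\<Sum>j\<le>n. measure lborel (A j) * (1 - (1 - Q (d * real (f j)))))))"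
        by (rule ppp_product_over_partition[OF ppp lam _ disj A_borel A_bounded nonneg(1)]) simp
      also have "(\<Sum>j\<le>n. measure lborel (A j) * (1 - (1 - Q (d * real (f j))))) =
          (\<Sum>j<n. measure lborel (A (Suc j)) * Q (d * real (f (Suc j))))"
        by (subst lessThan_Suc_atMost[symmetric], subst sum.lessThan_Suc_shift) (simp add: A_measure)
      also have "\<dots> = pi * (\<Sum>j<n. d * Q (d * real (f (Suc j))))"
        by (simp add: A_measure sum_distrib_left mult_ac)
      finally show ?thesis by (simp add: mult_ac)
    qed
    let ?L = "\<Sum>j<n. d * Q (d * real (Suc j))" and ?U = "\<Sum>j<n. d * Q (d * real j)"
    have "?L \<le> ?I" "?I \<le> ?U"
      using antimono_riemann_sums[OF cont anti less_imp_le[OF d], of n] unfolding dn by auto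
    \<comment> \<open>The difference of the two sums telescopes. Since \<open>Q\<close> takes values
      between 0 and 1, it is at most the step \<open>d\<close>, which is the error term
      \<open>D\<^sup>2 / real n\<close> of the bounds.\<close>
    moreover have "?U - ?L = d * (Q 0 - Q (d * real n))"
      using sum_lessThan_telescope'[of "\<lambda>j. d * Q (d * real j)" n]
      by (simp add: sum_subtractf algebra_simps)
    moreover have "d * (Q 0 - Q (d * real n)) \<le> d"
      using Q(1)[of "d * real n"] Q(2)[of 0] d by (simp add: mult_left_le)
    ultimately have "?U \<le> ?I + d" "?I - d \<le> ?L" by linarith+
    then have "- lam * pi * (?I + d) \<le> - lam * pi * ?U" "- lam * pi * ?L \<le> - lam * pi * (?I - d)"
      using lam by (auto intro!: mult_left_mono)
    then have "ennreal (exp (- lam * pi * (?I + d))) \<le> ennreal (exp (- lam * pi * ?U))"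
      "ennreal (exp (- lam * pi * ?L)) \<le> ennreal (exp (- lam * pi * (?I - d)))"
      by (simp_all add: ennreal_leI)
    moreover have "ennreal (exp (- lam * pi * ?U)) \<le> ?E"
    proof -
      have "ennreal (exp (- lam * pi * ?U)) =
          (\<integral>\<^sup>+w. ennreal (\<Prod>j\<le>n. (1 - Q (d * real (j - 1))) ^ count_in X (A j) w) \<partial>M)"
        unfolding step by simp
      also have "\<dots> \<le> ?E"
        unfolding E by (intro nn_integral_mono ennreal_leI sandwich(1))
      finally show ?thesis .
    qed
    moreover have "?E \<le> ennreal (exp (- lam * pi * ?L))"
    proof -
      have "?E \<le> (\<integral>\<^sup>+w. ennreal (\<Prod>j\<le>n. (1 - Q (d * real j)) ^ count_in X (A j) w) \<partial>M)"
        unfolding E by (intro nn_integral_mono ennreal_leI sandwich(2))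
      then show ?thesis unfolding step[of "\<lambda>j. j"] .
    qed
    ultimately show ?thesis
      unfolding d_def[symmetric] by (blast intro: order_trans)
  qed
  have ev: "eventually (\<lambda>n. ennreal (exp (- lam * pi * (?I + D\<^sup>2 / real n))) \<le> ?E) sequentially"
    "eventually (\<lambda>n. ?E \<le> ennreal (exp (- lam * pi * (?I - D\<^sup>2 / real n)))) sequentially"
    using eventually_gt_at_top[of "0::nat"] by (eventually_elim, use bounds in blast)+
  have "(\<lambda>n. ennreal (exp (- lam * pi * (?I + D\<^sup>2 / real n)))) \<longlonglongrightarrow> ennreal (exp (- lam * pi * (?I + 0)))"
    by (intro tendsto_ennrealI tendsto_intros lim_const_over_n)
  then have "ennreal (exp (- lam * pi * (?I + 0))) \<le> ?E"
    using ev(1) by (rule tendsto_upperbound) simp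
  moreover have "(\<lambda>n. ennreal (exp (- lam * pi * (?I - D\<^sup>2 / real n)))) \<longlonglongrightarrow> ennreal (exp (- lam * pi * (?I - 0)))"
    by (intro tendsto_ennrealI tendsto_intros lim_const_over_n)
  then have "?E \<le> ennreal (exp (- lam * pi * (?I - 0)))"
    using ev(2) by (rule tendsto_lowerbound) simp
  ultimately show ?thesis by simp
qed

end

section \<open>Substitution from the squared radius to the incomplete gamma function\<close>

lemma integral_radial_to_gamma:
  fixes \<alpha> c D :: real
  assumes \<alpha>: "0 < \<alpha>" and c: "0 < c" and D: "0 \<le> D"
  shows "integral {0..D\<^sup>2} (\<lambda>s. exp (- c * s powr (\<alpha> / 2))) =
    2 / \<alpha> * (1 / c) powr (2 / \<alpha>) * lower_incomplete_gamma (2 / \<alpha>) (c * D powr \<alpha>)"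
proof -
  let ?f = "\<lambda>s. exp (- c * s powr (\<alpha> / 2))"
  define F where "F u = integral {0..u} ?f" for u
  \<comment> \<open>\<open>\<phi>\<close> inverts the substitution t = c s^(\<alpha>/2) on the
    nonnegative reals; \<open>?z\<close> is the value of t at s = \<open>D\<^sup>2\<close>.\<close>
  define \<phi> where "\<phi> t = (t / c) powr (2 / \<alpha>)" for t
  let ?z = "c * D powr \<alpha>"
  have cont_f: "continuous_on {0..v} ?f" for v
    using \<alpha> by (intro continuous_on_exp continuous_on_mult continuous_on_powr' continuous_on_const continuous_on_id) auto
  have cont_F: "continuous_on {0..v} F" for v
    unfolding F_def by (intro indefinite_integral_continuous_1 integrable_continuous_real cont_f)
  have z: "0 \<le> ?z" using c by simp
  have \<phi>_z: "\<phi> ?z = D\<^sup>2"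
    using \<alpha> c D by (cases "D = 0") (simp_all add: \<phi>_def powr_powr powr_numeral)
  have "((\<lambda>t. exp (- t) * (2 / \<alpha> * (1 / c) powr (2 / \<alpha>) * t powr (2 / \<alpha> - 1))) has_integral F (\<phi> ?z) - F (\<phi> 0)) {0..?z}"
  \<comment> \<open>For \<alpha> > 2 the factor \<open>t powr (2 / \<alpha> - 1)\<close> is
    unbounded near 0. Hence the derivative is taken only in the interior, with continuity of the
    antiderivative up to the endpoints.\<close>
  proof (rule fundamental_theorem_of_calculus_interior[OF z])
    have "continuous_on {0..?z} \<phi>"
      unfolding \<phi>_def using \<alpha> c
      by (intro continuous_on_powr' continuous_on_divide continuous_on_const continuous_on_id) auto
    moreover have "\<phi> ` {0..?z} \<subseteq> {0..D\<^sup>2}"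
      using \<alpha> c by (auto simp: \<phi>_z[symmetric]) (auto simp: \<phi>_def pos_divide_le_eq mult.commute intro!: powr_mono2)
    ultimately show "continuous_on {0..?z} (\<lambda>t. F (\<phi> t))"
      by (intro continuous_on_compose2[OF cont_F])
    fix t assume t: "t \<in> {0<..<?z}"
    have pos: "0 < t / c" using t c by simp
    have \<phi>_pos: "0 < \<phi> t" using t c by (simp add: \<phi>_def)
    \<comment> \<open>The interval is extended beyond \<open>\<phi> t\<close> by 1 to make this an
      interior point, where the derivative within the interval is the full derivative.\<close>
    have "(F has_real_derivative ?f (\<phi> t)) (at (\<phi> t) within {0..\<phi> t + 1})"
      unfolding F_def using \<phi>_pos by (intro integral_has_real_derivative cont_f) simp
    then have dF: "(F has_real_derivative ?f (\<phi> t)) (at (\<phi> t))"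
      using \<phi>_pos by (simp add: at_within_Icc_at)
    have d\<phi>: "(\<phi> has_real_derivative 2 / \<alpha> * (t / c) powr (2 / \<alpha> - 1) * (1 / c)) (at t)"
      unfolding \<phi>_def using pos c by (auto intro!: derivative_eq_intros)
    have "?f (\<phi> t) = exp (- t)"
      using \<alpha> c t by (simp add: \<phi>_def powr_powr)
    moreover have "2 / \<alpha> * (t / c) powr (2 / \<alpha> - 1) * (1 / c) = 2 / \<alpha> * (1 / c) powr (2 / \<alpha>) * t powr (2 / \<alpha> - 1)"
      using t c by (simp add: powr_divide powr_diff)
    ultimately show "((\<lambda>t. F (\<phi> t)) has_vector_derivative exp (- t) * (2 / \<alpha> * (1 / c) powr (2 / \<alpha>) * t powr (2 / \<alpha> - 1))) (at t)"
      using DERIV_chain2[OF dF d\<phi>] by (simp add: has_real_derivative_iff_has_vector_derivative)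
  qed
  moreover have "F (\<phi> 0) = 0" using \<alpha> by (simp add: \<phi>_def F_def)
  ultimately have "((\<lambda>t. exp (- t) * (2 / \<alpha> * (1 / c) powr (2 / \<alpha>) * t powr (2 / \<alpha> - 1))) has_integral F (D\<^sup>2)) {0..?z}"
    unfolding \<phi>_z by simp
  then have "integral {0..?z} (\<lambda>t. exp (- t) * (2 / \<alpha> * (1 / c) powr (2 / \<alpha>) * t powr (2 / \<alpha> - 1))) = F (D\<^sup>2)"
    by (rule integral_unique)
  moreover have "integral {0..?z} (\<lambda>t. exp (- t) * (2 / \<alpha> * (1 / c) powr (2 / \<alpha>) * t powr (2 / \<alpha> - 1))) =
      integral {0..?z} (\<lambda>t. 2 / \<alpha> * (1 / c) powr (2 / \<alpha>) * (t powr (2 / \<alpha> - 1) * exp (- t)))"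
    by (simp add: mult_ac)
  ultimately show ?thesis
    by (simp add: F_def lower_incomplete_gamma_def)
qed

section \<open>Averaging over fading, locations and beams\<close>

context prob_space
begin

lemma indep_rv_sym:
  assumes "indep_rv N1 Z1 N2 Z2"
  shows "indep_rv N2 Z2 N1 Z1"
proof -
  let ?A = "{Z1 -` A \<inter> space M | A. A \<in> sets N1}" and ?B = "{Z2 -` A \<inter> space M | A. A \<in> sets N2}"
  have ind: "indep_set ?A ?B" using assms by (simp add: indep_rv_def)
  have "indep_set ?B ?A"
  proof (rule indep_setI)
    fix a b assume "a \<in> ?B" "b \<in> ?A"
    then show "prob (a \<inter> b) = prob a * prob b"
      using indep_setD[OF ind, of b a] by (simp add: Int_commute mult.commute)
  qed (use indep_setD_ev1[OF ind] indep_setD_ev2[OF ind] in auto)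
  then show ?thesis using assms by (simp add: indep_rv_def)
qed

text \<open>Fubini for the product law, pulled back to the sample space: the second sample point
  serves as an independent copy, so \<open>Z1\<close> can be frozen while the randomness of
  \<open>Z2\<close> is averaged.\<close>

lemma indep_rv_emeasure_condition:
  assumes ind: "indep_rv N1 Z1 N2 Z2" and S: "S \<in> sets (N1 \<Otimes>\<^sub>M N2)"
  shows "emeasure M {w\<in>space M. (Z1 w, Z2 w) \<in> S} =
    (\<integral>\<^sup>+v. emeasure M {w\<in>space M. (Z1 v, Z2 w) \<in> S} \<partial>M)"
proof -
  have [measurable]: "random_variable N1 Z1" "random_variable N2 Z2"
    using ind by (auto simp: indep_rv_def)
  interpret D2: prob_space "distr M N2 Z2" by (rule prob_space_distr) measurable
  have S': "S \<in> sets (distr M N1 Z1 \<Otimes>\<^sub>M distr M N2 Z2)"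
    using S sets_pair_measure_cong[of "distr M N1 Z1" N1 "distr M N2 Z2" N2] by simp
  have "emeasure M {w\<in>space M. (Z1 w, Z2 w) \<in> S} = emeasure (distr M (N1 \<Otimes>\<^sub>M N2) (\<lambda>w. (Z1 w, Z2 w))) S"
    by (subst emeasure_distr[OF _ S]) (auto intro!: arg_cong[where f="emeasure M"])
  also have "\<dots> = (\<integral>\<^sup>+z. emeasure (distr M N2 Z2) (Pair z -` S) \<partial>distr M N1 Z1)"
    unfolding indep_rv_distr[OF ind] by (rule D2.emeasure_pair_measure_alt[OF S'])
  also have "\<dots> = (\<integral>\<^sup>+v. emeasure (distr M N2 Z2) (Pair (Z1 v) -` S) \<partial>M)"
    using D2.measurable_emeasure_Pair[OF S'] by (intro nn_integral_distr) simp_all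
  also have "\<dots> = (\<integral>\<^sup>+v. emeasure M {w\<in>space M. (Z1 v, Z2 w) \<in> S} \<partial>M)"
    by (intro nn_integral_cong, subst emeasure_distr)
      (auto intro!: sets_Pair1[OF S] arg_cong[where f="emeasure M"])
  finally show ?thesis .
qed

end

section \<open>Measurability and elementary properties of the SINR and its maximum\<close>

lemma tdot_measurable [measurable (raw)]:
  fixes f g :: "'a \<Rightarrow> complex ^ 'n"
  assumes [measurable]: "f \<in> borel_measurable M" "g \<in> borel_measurable M"
  shows "(\<lambda>w. tdot (f w) (g w)) \<in> borel_measurable M"
proof -
  have [measurable]: "(\<lambda>v :: complex ^ 'n. v $ j) \<in> borel_measurable borel" for j
    by (intro borel_measurable_continuous_onI continuous_intros)
  show ?thesis unfolding tdot_def by measurable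
qed

lemma path_loss_pos: "0 < path_loss \<alpha> d"
  by (simp add: path_loss_def add_pos_nonneg)

lemma path_loss_measurable [measurable]: "path_loss \<alpha> \<in> borel_measurable borel"
  unfolding path_loss_def by measurable

lemma powr_half_power2: "0 \<le> r \<Longrightarrow> (r\<^sup>2) powr (\<alpha> / 2) = (r::real) powr \<alpha>"
  by (cases "r = 0") (simp_all add: powr_powr flip: powr_numeral)

context obf_network
begin

lemma X_measurable [measurable]: "X i \<in> borel_measurable \<Omega>"
  using users_ppp by (simp add: homogeneous_ppp_def)

lemma h_measurable [measurable]: "h i \<in> borel_measurable \<Omega>"
  using fading_indep by (simp add: indep_vars_def)

lemma b_measurable [measurable]: "b k \<in> borel_measurable \<Omega>"
proof -
  have "(\<lambda>w k. b k w) \<in> measurable \<Omega> (PiM UNIV (\<lambda>_. borel))"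
    using beams_indep by (simp add: indep_rv_def)
  from measurable_compose[OF this measurable_component_singleton[of k]]
  show ?thesis by simp
qed

lemma finite_users_in_cell: "w \<in> space \<Omega> \<Longrightarrow> finite (users_in_cell D X w)"
  unfolding users_in_cell_def by (rule ppp_locally_finite[OF users_ppp]) simp_all

lemma sinr_nonneg: "0 \<le> sinr rho (path_loss \<alpha>) X h b m i w"
  unfolding sinr_def using rho_pos path_loss_pos[of \<alpha> "norm (X i w)"]
  by (auto intro!: divide_nonneg_nonneg add_nonneg_nonneg sum_nonneg)

text \<open>The noise term keeps the denominator strictly positive, so the division can be cleared;
  the result compares the power of beam \<open>m\<close> with the other powers.\<close>

lemma sinr_le_iff:
  "sinr rho (path_loss \<alpha>) X h b m i w \<le> y \<longleftrightarrow>
    (norm (tdot (h i w) (b m w)))\<^sup>2 \<le>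
      y * (inverse (rho * path_loss \<alpha> (norm (X i w))) + (\<Sum>k\<in>UNIV - {m}. (norm (tdot (h i w) (b k w)))\<^sup>2))"
proof -
  have "0 < inverse (rho * path_loss \<alpha> (norm (X i w))) + (\<Sum>k\<in>UNIV - {m}. (norm (tdot (h i w) (b k w)))\<^sup>2)"
    using rho_pos path_loss_pos[of \<alpha> "norm (X i w)"] by (intro add_pos_nonneg sum_nonneg) auto
  then show ?thesis unfolding sinr_def by (simp add: pos_divide_le_eq)
qed

lemma max_sinr_nonneg:
  assumes "w \<in> space \<Omega>"
  shows "0 \<le> max_sinr D rho (path_loss \<alpha>) X h b m w"
proof (cases "users_in_cell D X w = {}")
  case False
  then obtain i where "i \<in> users_in_cell D X w" by auto
  then have "sinr rho (path_loss \<alpha>) X h b m i w \<le> max_sinr D rho (path_loss \<alpha>) X h b m w"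
    using finite_users_in_cell[OF assms] False by (simp add: max_sinr_def)
  then show ?thesis using sinr_nonneg[of \<alpha> m i w] by linarith
qed (simp add: max_sinr_def)

text \<open>For a nonempty cell this is the property of a finite maximum. For an empty cell both
  sides hold, the left one because the default value 0 is at most \<open>y\<close>.\<close>

lemma max_sinr_le_iff:
  assumes "w \<in> space \<Omega>" "0 \<le> y"
  shows "max_sinr D rho (path_loss \<alpha>) X h b m w \<le> y \<longleftrightarrow>
    (\<forall>i. X i w \<in> cball 0 D \<longrightarrow> sinr rho (path_loss \<alpha>) X h b m i w \<le> y)"
  using finite_users_in_cell[OF assms(1)] assms(2)
  by (auto simp: max_sinr_def users_in_cell_def)

lemma sinr_measurable [measurable]: "sinr rho (path_loss \<alpha>) X h b m i \<in> borel_measurable \<Omega>"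
  unfolding sinr_def[abs_def] by measurable

text \<open>Sublevel sets for nonnegative levels are countable intersections over the user indices,
  which avoids a maximum over a random index set; for negative levels they are empty.\<close>

lemma max_sinr_measurable [measurable]:
  "max_sinr D rho (path_loss \<alpha>) X h b m \<in> borel_measurable \<Omega>"
proof (rule borel_measurableI_le)
  fix y
  show "{w \<in> space \<Omega>. max_sinr D rho (path_loss \<alpha>) X h b m w \<le> y} \<in> sets \<Omega>"
  proof (cases "0 \<le> y")
    case True
    then have "{w \<in> space \<Omega>. max_sinr D rho (path_loss \<alpha>) X h b m w \<le> y} =
      {w \<in> space \<Omega>. \<forall>i. X i w \<in> cball 0 D \<longrightarrow> sinr rho (path_loss \<alpha>) X h b m i w \<le> y}"
      using max_sinr_le_iff by blast
    also have "\<dots> \<in> sets \<Omega>" unfolding mem_cball_0 by measurable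
    finally show ?thesis .
  next
    case False
    then have "{w \<in> space \<Omega>. max_sinr D rho (path_loss \<alpha>) X h b m w \<le> y} = {}"
      using max_sinr_nonneg[of _ \<alpha> m] by force
    then show ?thesis by (simp only: sets.empty_sets)
  qed
qed

lemma max_sinr_cdf_eq:
  "max_sinr_cdf \<Omega> D rho (path_loss \<alpha>) X h b m y =
    prob {w \<in> space \<Omega>. max_sinr D rho (path_loss \<alpha>) X h b m w \<le> y}"
  unfolding max_sinr_cdf_def cdf_def
  by (subst measure_distr) (auto intro!: arg_cong[where f=prob])

lemma beam_outage_eq_cdf:
  "beam_outage \<Omega> D rho (path_loss \<alpha>) X h b m x = max_sinr_cdf \<Omega> D rho (path_loss \<alpha>) X h b m (exp x - 1)"
proof -
  have "beam_rate D rho (path_loss \<alpha>) X h b m w \<le> x \<longleftrightarrow> max_sinr D rho (path_loss \<alpha>) X h b m w \<le> exp x - 1"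
    if "w \<in> space \<Omega>" for w
  proof -
    have "0 < 1 + max_sinr D rho (path_loss \<alpha>) X h b m w"
      using max_sinr_nonneg[OF that, of \<alpha> m] by linarith
    then have "ln (1 + max_sinr D rho (path_loss \<alpha>) X h b m w) \<le> x \<longleftrightarrow>
        1 + max_sinr D rho (path_loss \<alpha>) X h b m w \<le> exp x"
      by (metis exp_le_cancel_iff exp_ln)
    then show ?thesis unfolding beam_rate_def by linarith
  qed
  then show ?thesis
    unfolding beam_outage_def max_sinr_cdf_eq by (intro arg_cong[where f=prob]) auto
qed

section \<open>Conditional probabilities and the closed form of the distribution function\<close>

text \<open>The probability that the SINR of a user at squared distance \<open>s\<close> exceeds \<open>y\<close>.\<close>

definition user_tail :: "real \<Rightarrow> real \<Rightarrow> real \<Rightarrow> real" where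
  "user_tail \<alpha> y s = exp (- (y / rho) * (1 + s powr (\<alpha> / 2))) / (1 + y) ^ (CARD('m) - 1)"

text \<open>The beams and the locations are frozen at the sample points \<open>v\<close> and \<open>u\<close>; only the fading is averaged.\<close>

lemma prob_all_sinr_le_given_beams_locations:
  assumes y: "0 \<le> y" and v: "v \<in> space \<Omega>" and u: "u \<in> space \<Omega>"
  shows "emeasure \<Omega> {w \<in> space \<Omega>. \<forall>i. X i u \<in> cball 0 D \<longrightarrow>
      (norm (tdot (h i w) (b m v)))\<^sup>2 \<le>
        y * (inverse (rho * path_loss \<alpha> (norm (X i u))) + (\<Sum>k\<in>UNIV - {m}. (norm (tdot (h i w) (b k v)))\<^sup>2))} =
    (\<Prod>i\<in>users_in_cell D X u. ennreal (1 - user_tail \<alpha> y ((norm (X i u))\<^sup>2)))"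
proof -
  let ?J = "users_in_cell D X u"
  define c where "c i = inverse (rho * path_loss \<alpha> (norm (X i u)))" for i
  \<comment> \<open>\<open>A i\<close> collects the fading vectors for which user \<open>i\<close>
    stays at or below the SINR level; it is closed, and its complement is the event of the Gaussian
    tail formula.\<close>
  define A where "A i = {z. (norm (tdot z (b m v)))\<^sup>2 \<le> y * (c i + (\<Sum>k\<in>UNIV - {m}. (norm (tdot z (b k v)))\<^sup>2))}" for i
  have "closed (A i)" for i
    unfolding A_def tdot_def by (intro closed_Collect_le continuous_intros)
  then have A[measurable]: "A i \<in> sets borel" for i by simp
  have c_eq: "c i = (1 + ((norm (X i u))\<^sup>2) powr (\<alpha> / 2)) / rho" for i
    using rho_pos by (simp add: c_def path_loss_def powr_half_power2 field_simps)
  have c: "0 \<le> c i" for i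
    using rho_pos by (simp add: c_eq)
  have single: "prob (h i -` A i \<inter> space \<Omega>) = 1 - user_tail \<alpha> y ((norm (X i u))\<^sup>2)" for i
  proof -
    let ?B = "{w\<in>space \<Omega>. y * (c i + (\<Sum>k\<in>UNIV - {m}. (norm (tdot (h i w) (b k v)))\<^sup>2)) < (norm (tdot (h i w) (b m v)))\<^sup>2}"
    have "h i -` A i \<inter> space \<Omega> = space \<Omega> - ?B"
      by (auto simp: A_def)
    moreover have "prob ?B = exp (- y * c i) / (1 + y) ^ (CARD('m) - 1)"
      by (rule gaussian_vector_beam_sinr_tail[OF h_measurable fading_entries_indep fading_entries_gaussian
            beams_orthonormal[OF v] y c])
    moreover have "?B \<in> events" by measurable
    ultimately show ?thesis
      by (simp add: prob_compl user_tail_def c_eq)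
  qed
  have "emeasure \<Omega> {w \<in> space \<Omega>. \<forall>i. X i u \<in> cball 0 D \<longrightarrow> h i w \<in> A i} =
      (\<Prod>i\<in>?J. ennreal (prob (h i -` A i \<inter> space \<Omega>)))"
  \<comment> \<open>The product rule for independent events asks for a nonempty index set; an empty
    cell gives the sure event and the empty product.\<close>
  proof (cases "?J = {}")
    case True
    then show ?thesis by (auto simp: users_in_cell_def emeasure_space_1)
  next
    case False
    have "{w \<in> space \<Omega>. \<forall>i. X i u \<in> cball 0 D \<longrightarrow> h i w \<in> A i} = (\<Inter>i\<in>?J. h i -` A i \<inter> space \<Omega>)"
      using False by (auto simp: users_in_cell_def)
    then have "emeasure \<Omega> {w \<in> space \<Omega>. \<forall>i. X i u \<in> cball 0 D \<longrightarrow> h i w \<in> A i} =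
        ennreal (\<Prod>i\<in>?J. prob (h i -` A i \<inter> space \<Omega>))"
      using indep_varsD[OF fading_indep False finite_users_in_cell[OF u], of A]
      by (simp add: emeasure_eq_measure)
    then show ?thesis by (simp add: prod_ennreal)
  qed
  then show ?thesis
    unfolding single by (simp add: A_def c_def)
qed

text \<open>The beams are frozen first, then the locations, and the fading is averaged innermost.
  The inner probability is the same for all orthonormal beams, so the outer average over the beams
  is that of a constant.\<close>

lemma emeasure_max_sinr_le:
  assumes y: "0 \<le> y"
  shows "emeasure \<Omega> {w \<in> space \<Omega>. max_sinr D rho (path_loss \<alpha>) X h b m w \<le> y} =
    (\<integral>\<^sup>+u. (\<Prod>i\<in>users_in_cell D X u. ennreal (1 - user_tail \<alpha> y ((norm (X i u))\<^sup>2))) \<partial>\<Omega>)"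
proof -
  let ?B = "PiM (UNIV :: 'm set) (\<lambda>_. borel :: (complex ^ 'm) measure)"
  let ?H = "PiM (UNIV :: nat set) (\<lambda>_. borel :: (complex ^ 'm) measure)"
  let ?X = "PiM (UNIV :: nat set) (\<lambda>_. borel :: plane measure)"
  define ok where "ok \<beta> \<eta> \<xi> \<longleftrightarrow> (\<forall>i. \<xi> i \<in> cball 0 D \<longrightarrow>
      (norm (tdot (\<eta> i) (\<beta> m)))\<^sup>2 \<le>
        y * (inverse (rho * path_loss \<alpha> (norm (\<xi> i))) + (\<Sum>k\<in>UNIV - {m}. (norm (tdot (\<eta> i) (\<beta> k)))\<^sup>2)))"
    for \<beta> :: "'m \<Rightarrow> complex ^ 'm" and \<eta> :: "nat \<Rightarrow> complex ^ 'm" and \<xi> :: "nat \<Rightarrow> plane"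
  \<comment> \<open>Stated for arbitrary measurable arguments, this covers both the joint event
    \<open>S\<close> and its section \<open>S'\<close> at fixed beams.\<close>
  have ok_meas: "{z \<in> space N. ok (f z) (g z) (e z)} \<in> sets N"
    if f: "f \<in> measurable N ?B" and g: "g \<in> measurable N ?H" and e: "e \<in> measurable N ?X"
    for f g e and N :: "'z measure"
  proof -
    have [measurable]: "(\<lambda>z. f z k) \<in> borel_measurable N" "(\<lambda>z. g z i) \<in> borel_measurable N"
      "(\<lambda>z. e z i) \<in> borel_measurable N" for k i
      using measurable_compose[OF f measurable_component_singleton[of k]]
        measurable_compose[OF g measurable_component_singleton[of i]]
        measurable_compose[OF e measurable_component_singleton[of i]] by simp_all
    show ?thesis unfolding ok_def mem_cball_0 by measurable
  qed
  define S where "S = {z \<in> space (?B \<Otimes>\<^sub>M (?H \<Otimes>\<^sub>M ?X)). ok (fst z) (fst (snd z)) (snd (snd z))}"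
  have S: "S \<in> sets (?B \<Otimes>\<^sub>M (?H \<Otimes>\<^sub>M ?X))"
    unfolding S_def by (rule ok_meas) measurable
  have "emeasure \<Omega> {w \<in> space \<Omega>. max_sinr D rho (path_loss \<alpha>) X h b m w \<le> y} =
      emeasure \<Omega> {w \<in> space \<Omega>. ((\<lambda>k. b k w), (\<lambda>i. h i w, \<lambda>i. X i w)) \<in> S}"
    using max_sinr_le_iff[OF _ y, of _ \<alpha> m]
    by (intro arg_cong[where f="emeasure \<Omega>"])
      (auto simp: S_def ok_def sinr_le_iff space_pair_measure space_PiM)
  also have "\<dots> = (\<integral>\<^sup>+v. emeasure \<Omega> {w \<in> space \<Omega>. ((\<lambda>k. b k v), (\<lambda>i. h i w, \<lambda>i. X i w)) \<in> S} \<partial>\<Omega>)"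
    by (rule indep_rv_emeasure_condition[OF beams_indep S])
  also have "\<dots> = (\<integral>\<^sup>+v. (\<integral>\<^sup>+u. (\<Prod>i\<in>users_in_cell D X u. ennreal (1 - user_tail \<alpha> y ((norm (X i u))\<^sup>2))) \<partial>\<Omega>) \<partial>\<Omega>)"
  proof (rule nn_integral_cong)
    fix v assume v: "v \<in> space \<Omega>"
    \<comment> \<open>The pair is reordered with the locations first, since conditioning freezes the
      first component.\<close>
    define S' where "S' = {z \<in> space (?X \<Otimes>\<^sub>M ?H). ok (\<lambda>k. b k v) (snd z) (fst z)}"
    have S': "S' \<in> sets (?X \<Otimes>\<^sub>M ?H)"
      unfolding S'_def by (rule ok_meas) (auto simp: space_PiM)
    have "{w \<in> space \<Omega>. ((\<lambda>k. b k v), (\<lambda>i. h i w, \<lambda>i. X i w)) \<in> S} =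
        {w \<in> space \<Omega>. ((\<lambda>i. X i w), (\<lambda>i. h i w)) \<in> S'}"
      by (auto simp: S_def S'_def space_pair_measure space_PiM)
    then have "emeasure \<Omega> {w \<in> space \<Omega>. ((\<lambda>k. b k v), (\<lambda>i. h i w, \<lambda>i. X i w)) \<in> S} =
        (\<integral>\<^sup>+u. emeasure \<Omega> {w \<in> space \<Omega>. ((\<lambda>i. X i u), (\<lambda>i. h i w)) \<in> S'} \<partial>\<Omega>)"
      using indep_rv_emeasure_condition[OF indep_rv_sym[OF fading_indep_locations] S'] by simp
    also have "\<dots> = (\<integral>\<^sup>+u. (\<Prod>i\<in>users_in_cell D X u. ennreal (1 - user_tail \<alpha> y ((norm (X i u))\<^sup>2))) \<partial>\<Omega>)"
      by (intro nn_integral_cong, subst prob_all_sinr_le_given_beams_locations[OF y v, symmetric])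
        (auto simp: S'_def ok_def space_pair_measure space_PiM)
    finally show "emeasure \<Omega> {w \<in> space \<Omega>. ((\<lambda>k. b k v), (\<lambda>i. h i w, \<lambda>i. X i w)) \<in> S} =
        (\<integral>\<^sup>+u. (\<Prod>i\<in>users_in_cell D X u. ennreal (1 - user_tail \<alpha> y ((norm (X i u))\<^sup>2))) \<partial>\<Omega>)" .
  qed
  also have "\<dots> = (\<integral>\<^sup>+u. (\<Prod>i\<in>users_in_cell D X u. ennreal (1 - user_tail \<alpha> y ((norm (X i u))\<^sup>2))) \<partial>\<Omega>)"
    by (simp add: emeasure_space_1)
  finally show ?thesis .
qed

text \<open>\<open>user_tail\<close> is continuous and decreasing in the squared distance with
  values between 0 and 1, so the Poisson generating functional applies. The summand 1 in the path
  loss contributes the constant factor exp(-y/rho); the remaining radial integral is the one with c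
  = y/rho.\<close>

lemma max_sinr_cdf_path_loss:
  assumes \<alpha>: "0 < \<alpha>" and y: "0 < y"
  shows "max_sinr_cdf \<Omega> D rho (path_loss \<alpha>) X h b m y =
    exp (- 2 * lam * pi * exp (- y / rho) / (\<alpha> * (y + 1) ^ (CARD('m) - 1)) *
      (rho / y) powr (2 / \<alpha>) * lower_incomplete_gamma (2 / \<alpha>) (y * D powr \<alpha> / rho))"
proof -
  let ?Q = "user_tail \<alpha> y"
  have c: "0 < y / rho" using y rho_pos by simp
  have "continuous_on {0..} ?Q"
    unfolding user_tail_def using \<alpha> y
    by (intro continuous_on_divide continuous_on_exp continuous_on_mult continuous_on_add
        continuous_on_powr' continuous_on_const continuous_on_id) auto
  moreover have "antimono_on {0..} ?Q"
    unfolding user_tail_def using \<alpha> y rho_pos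
    by (auto simp: monotone_on_def intro!: divide_right_mono powr_mono2 mult_left_mono)
  moreover have "0 \<le> ?Q s" for s
    using y by (simp add: user_tail_def)
  moreover have "?Q s \<le> 1" for s
  proof -
    have "0 \<le> (y / rho) * (1 + s powr (\<alpha> / 2))" using c by (intro mult_nonneg_nonneg) auto
    then have "exp (- (y / rho) * (1 + s powr (\<alpha> / 2))) \<le> 1" by simp
    also have "1 \<le> (1 + y) ^ (CARD('m) - 1)" using y by (intro one_le_power) simp
    finally show ?thesis using y by (simp add: user_tail_def)
  qed
  ultimately have "ennreal (max_sinr_cdf \<Omega> D rho (path_loss \<alpha>) X h b m y) =
      ennreal (exp (- lam * pi * integral {0..D\<^sup>2} ?Q))"
    unfolding max_sinr_cdf_eq emeasure_eq_measure[symmetric] emeasure_max_sinr_le[OF less_imp_le[OF y]]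
    using lam_pos D_pos by (intro ppp_radial_generating_functional[OF users_ppp]) auto
  then have "max_sinr_cdf \<Omega> D rho (path_loss \<alpha>) X h b m y = exp (- lam * pi * integral {0..D\<^sup>2} ?Q)"
    by (simp add: max_sinr_cdf_eq)
  also have "integral {0..D\<^sup>2} ?Q =
      integral {0..D\<^sup>2} (\<lambda>s. exp (- y / rho) / (1 + y) ^ (CARD('m) - 1) * exp (- (y / rho) * s powr (\<alpha> / 2)))"
    unfolding user_tail_def by (simp add: exp_add[symmetric] algebra_simps add_divide_distrib)
  also have "\<dots> = exp (- y / rho) / (1 + y) ^ (CARD('m) - 1) *
      (2 / \<alpha> * (1 / (y / rho)) powr (2 / \<alpha>) * lower_incomplete_gamma (2 / \<alpha>) ((y / rho) * D powr \<alpha>))"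
    using integral_radial_to_gamma[OF \<alpha> c, of D] D_pos by simp
  finally show ?thesis
    by (simp add: mult_ac add.commute)
qed

end

theorem lemma2:
  fixes \<Omega> :: "'w measure"
    and lam D rho \<alpha> x :: real
    and X :: "nat \<Rightarrow> 'w \<Rightarrow> plane"
    and h :: "nat \<Rightarrow> 'w \<Rightarrow> complex ^ 'm"
    and b :: "'m \<Rightarrow> 'w \<Rightarrow> complex ^ 'm"
    and m :: 'm
  assumes "obf_network \<Omega> lam D rho X h b"
    and "\<alpha> > 2"
    and "x > 0"
  shows "beam_outage \<Omega> D rho (path_loss \<alpha>) X h b m x =
           max_sinr_cdf \<Omega> D rho (path_loss \<alpha>) X h b m (exp x - 1) \<and>
         (\<forall>y>0. max_sinr_cdf \<Omega> D rho (path_loss \<alpha>) X h b m y =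
           exp (- 2 * lam * pi * exp (- y / rho) / (\<alpha> * (y + 1) ^ (CARD('m) - 1)) *
                (rho / y) powr (2 / \<alpha>) *
                lower_incomplete_gamma (2 / \<alpha>) (y * D powr \<alpha> / rho)))"
proof -
  interpret obf_network \<Omega> lam D rho X h b by fact
  show ?thesis
    using beam_outage_eq_cdf max_sinr_cdf_path_loss \<open>\<alpha> > 2\<close> by simp
qed

end
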